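(* Let $p>3$ be a prime. Then $$\sum_{k=0}^{p-1}D_k\equiv\left(\frac{-1}p\right)-p^2E_{p-3}\pmod{p^3}.$$ We also have $$\sum_{k=0}^{p-1}(2k+1)(-1)^kD_k\equiv p-\frac7{12}p^4B_{p-3}\pmod{p^5}$$ and $$\sum_{k=0}^{p-1}(2k+1)D_k\equiv p+2p^2q_p(2)-p^3q_p(2)^2\pmod{p^4}.$$
   Context: The central Delannoy numbers are $D_n=\sum_{k=0}^n\binom{n+k}{2k}\binom{2k}k=\sum_{k=0}^n\binom nk\binom{n+k}k$ for $n\in\{0,1,2,\ldots\}$. The symbol $\left(\frac{\cdot}p\right)$ is the Legendre symbol, and $q_p(2)=(2^{p-1}-1)/p$ is the Fermat quotient. The Bernoulli numbers are given by $B_0=1$ and $\sum_{k=0}^n\binom{n+1}kB_k=0$ for $n\ge1$. The Euler numbers are given by $E_0=1$ and $\sum_{0\le k\le n,\ 2\mid k}\binom nkE_{n-k}=0$ for $n\ge1$. For rational numbers $a,b$ and $m\ge1$, $a\equiv b\pmod{p^m}$ means that $(a-b)/p^m$ has denominator prime to $p$. *)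

theory Defs
  imports "HOL-Number_Theory.Number_Theory"
begin

definition delannoy :: "nat \<Rightarrow> nat" where
  "delannoy n = (\<Sum>k=0..n. ((n + k) choose (2 * k)) * ((2 * k) choose k))"

lemma delannoy_altdef: "delannoy n = (\<Sum>k=0..n. (n choose k) * ((n + k) choose k))"
  unfolding delannoy_def
proof (rule sum.cong[OF refl])
  fix k assume "k \<in> {0..n}"
  hence "((n + k) choose (2 * k)) * ((2 * k) choose k) = ((n + k) choose k) * ((n + k - k) choose (2 * k - k))"
    by (intro choose_mult) auto
  thus "((n + k) choose (2 * k)) * ((2 * k) choose k) = (n choose k) * ((n + k) choose k)"
    by (simp add: mult_2)
qed

text \<open>
  The Bernoulli and Euler numbers are obtained by solving the defining recurrences for the term
  of highest index; the recurrences themselves are the lemmas following the definitions.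
\<close>

fun bernoulli :: "nat \<Rightarrow> rat" where
  "bernoulli n =
     (if n = 0 then 1
      else - (\<Sum>k\<in>{..<n}. of_nat ((n + 1) choose k) * bernoulli k) / of_nat (n + 1))"

declare bernoulli.simps [simp del]

lemma bernoulli_0: "bernoulli 0 = 1"
  by (simp add: bernoulli.simps)

lemma bernoulli_recurrence:
  assumes "n \<ge> 1"
  shows "(\<Sum>k=0..n. of_nat ((n + 1) choose k) * bernoulli k) = 0"
proof -
  have "{0..n} = insert n {..<n}" by auto
  moreover have "of_nat ((n + 1) choose n) * bernoulli n =
      - (\<Sum>k\<in>{..<n}. of_nat ((n + 1) choose k) * bernoulli k)"
    using assms by (subst bernoulli.simps) (simp add: field_simps del: of_nat_Suc of_nat_add)
  ultimately show ?thesis by simp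
qed

fun euler_number :: "nat \<Rightarrow> int" where
  "euler_number n =
     (if n = 0 then 1
      else - (\<Sum>k | 1 \<le> k \<and> k \<le> n \<and> even k. of_nat (n choose k) * euler_number (n - k)))"

declare euler_number.simps [simp del]

lemma euler_number_0: "euler_number 0 = 1"
  by (simp add: euler_number.simps)

lemma euler_number_recurrence:
  assumes "n \<ge> 1"
  shows "(\<Sum>k | 0 \<le> k \<and> k \<le> n \<and> even k. of_nat (n choose k) * euler_number (n - k)) = 0"
proof -
  have fin: "finite {k. 1 \<le> k \<and> k \<le> n \<and> even k}"
    by (rule finite_subset[of _ "{..n}"]) auto
  have "{k. 0 \<le> k \<and> k \<le> n \<and> even k} = insert 0 {k. 1 \<le> k \<and> k \<le> n \<and> even k}" 
    by (auto simp: Suc_le_eq)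
  moreover have "euler_number n =
      - (\<Sum>k | 1 \<le> k \<and> k \<le> n \<and> even k. of_nat (n choose k) * euler_number (n - k))"
    using assms by (subst euler_number.simps) simp
  ultimately show ?thesis using fin by simp
qed

definition fermat_quotient :: "nat \<Rightarrow> int \<Rightarrow> rat" where
  "fermat_quotient p a = (of_int a ^ (p - 1) - 1) / of_nat p"

text \<open>Congruence of rationals modulo \<open>p ^ m\<close>; \<open>quotient_of\<close> yields lowest terms.\<close>

definition rat_cong :: "nat \<Rightarrow> nat \<Rightarrow> rat \<Rightarrow> rat \<Rightarrow> bool" where
  "rat_cong p m a b \<longleftrightarrow> coprime (snd (quotient_of ((a - b) / of_nat p ^ m))) (int p)"

end

theory Submission
  imports Defs
begin

text \<open>
  Write \<open>p = 2n + 1\<close> and \<open>w\<^sub>k = (\<Prod>j=1..k. 1 - p\<^sup>2/j\<^sup>2)\<close>. Exchanging the order of summation, each of the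
  three inner sums of binomial coefficients telescopes, and the same product \<open>p (-1)\<^sup>k w\<^sub>k\<close> comes out every time:
  the three sums are exactly \<open>\<Sum>k<p. p (-1)\<^sup>k w\<^sub>k c\<^sub>k\<close> with \<open>c\<^sub>k = 1/(2k+1)\<close>, \<open>1\<close> and \<open>p/(k+1)\<close>
  (\<open>sum_delannoy\<close>, \<open>sum_alternating_weighted_delannoy\<close>, \<open>sum_weighted_delannoy\<close>). Since
  \<open>w\<^sub>k \<equiv> 1 - p\<^sup>2 (\<Sum>j=1..k. 1/j\<^sup>2)\<close> modulo \<open>p\<^sup>4\<close>, everything reduces to harmonic sums.

  First sum. The central term \<open>k = n\<close>, where \<open>p\<close> cancels, gives \<open>(-1)\<^sup>n = (-1/p)\<close>. Pairing \<open>k\<close> with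
  \<open>2n - k\<close> turns the others into \<open>-2p\<^sup>2 \<Sum>k<n. (-1)\<^sup>k/(2k+1)\<^sup>2\<close>. By Fermat the inverse squares are
  powers with exponent \<open>p - 3\<close>, and an alternating sum of powers of odd numbers telescopes by means of the Euler
  polynomials (\<open>alternating_odd_power_sum\<close>).

  Second sum. Exactly, \<open>\<Sum>k<p. (-1)\<^sup>k (\<Sum>j=1..k. 1/j\<^sup>2)\<close> keeps only the even \<open>j\<close>, so it is a quarter of
  \<open>H = (\<Sum>j=1..n. 1/j\<^sup>2)\<close>, and one needs \<open>H \<equiv> 7/3 p B\<^bsub>p-3\<^esub>\<close> modulo \<open>p\<^sup>2\<close>. The range \<open>1..p-1\<close> is
  covered both by the pairs \<open>j, p - j\<close> with \<open>j \<le> n\<close> and by the pairs \<open>2j, p - 2j\<close> with \<open>j \<le> n\<close>;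
  comparing the two evaluations of one and the same full sum (\<open>rat_cong_reflection\<close>) relates the half sums
  of \<open>j\<^sup>-\<^sup>2\<close> and \<open>j\<^sup>-\<^sup>3\<close>. Applied to the powers \<open>j\<^bsup>p-3\<^esup>\<close>, whose full sum is \<open>p B\<^bsub>p-3\<^esub>\<close> by Faulhaber's
  formula, the same comparison evaluates the half sum of \<open>j\<^sup>-\<^sup>3\<close>.

  Third sum. The term \<open>k = p - 1\<close> contributes \<open>p\<close> modulo \<open>p\<^sup>4\<close>, and the rest \<open>-p\<^sup>2 (\<Sum>j=1..n. 1/j)\<close>. Evaluating
  \<open>(p-1)!\<close> by the same two pairings gives \<open>\<Prod>(1 - p/j) = 2\<^bsup>p-1\<^esup> \<Prod>(1 - p/(2j))\<close> over \<open>j \<le> n\<close>; expanding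
  both sides to second order in \<open>p\<close> expresses the harmonic sum through the Fermat quotient.
\<close>

section \<open>Rationals that are integral at a prime\<close>

text \<open>The valuation ring of \<open>p\<close> in \<open>\<rat>\<close>: the rationals whose denominator in
  lowest terms is prime to \<open>p\<close>. Calculations modulo \<open>p ^ m\<close> are calculations with an
  explicit remainder \<open>p ^ m * c\<close> for \<open>c\<close> in this ring.\<close>

definition p_integral :: "nat \<Rightarrow> rat set" where
  "p_integral p = {x. coprime (snd (quotient_of x)) (int p)}"

lemma rat_cong_iff_p_integral:
  "rat_cong p m a b \<longleftrightarrow> (a - b) / of_nat p ^ m \<in> p_integral p"
  by (simp add: rat_cong_def p_integral_def)

text \<open>The fraction need not be in lowest terms: cancelling only replaces the denominator by one of its
  divisors.\<close>

lemma p_integral_fractionI: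
  assumes "coprime b (int p)" "b \<noteq> 0"
  shows "of_int a / of_int b \<in> p_integral p"
proof -
  obtain c d where cd: "quotient_of (of_int a / of_int b) = (c, d)"
    by fastforce
  have d0: "d > 0" and cop: "coprime c d" and eq: "of_int a / of_int b = (of_int c / of_int d :: rat)"
    using quotient_of_denom_pos[OF cd] quotient_of_coprime[OF cd] quotient_of_div[OF cd] by auto
  from eq d0 assms have "of_int (a * d) = (of_int (c * b) :: rat)"
    by (simp add: field_simps)
  hence "a * d = c * b" by (simp only: of_int_eq_iff)
  hence "d dvd c * b" by (metis dvd_triv_right)
  hence "d dvd b" using cop by (simp add: coprime_commute coprime_dvd_mult_right_iff)
  hence "coprime d (int p)" using assms(1) by (meson coprime_divisors dvd_refl)
  thus ?thesis by (simp add: p_integral_def cd)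
qed

lemma p_integralE:
  assumes "x \<in> p_integral p"
  obtains a b where "coprime b (int p)" "b > 0" "x = of_int a / of_int b"
proof -
  obtain c d where cd: "quotient_of x = (c, d)" by fastforce
  show thesis
    by (rule that[of d c]) (use assms cd quotient_of_denom_pos[OF cd] quotient_of_div[OF cd]
        in \<open>auto simp: p_integral_def\<close>)
qed

lemma p_integral_of_int [simp, intro]: "of_int a \<in> p_integral p"
  using p_integral_fractionI[of 1 p a] by simp

lemma p_integral_of_nat [simp, intro]: "of_nat a \<in> p_integral p"
  using p_integral_of_int[of "int a" p] by simp

lemma p_integral_numeral [simp, intro]: "numeral a \<in> p_integral p"
  using p_integral_of_nat[of "numeral a" p] by simp

lemma p_integral_0 [simp, intro]: "0 \<in> p_integral p"
  and p_integral_1 [simp, intro]: "1 \<in> p_integral p"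
  using p_integral_of_nat[of 0 p] p_integral_of_nat[of 1 p] by simp_all

lemma p_integral_add [simp, intro]:
  assumes "x \<in> p_integral p" "y \<in> p_integral p"
  shows "x + y \<in> p_integral p"
proof -
  obtain a b c d where *: "coprime b (int p)" "b > 0" "x = of_int a / of_int b"
    "coprime d (int p)" "d > 0" "y = of_int c / of_int d"
    using assms by (elim p_integralE)
  hence "x + y = of_int (a * d + c * b) / of_int (b * d)"
    by (simp add: field_simps)
  moreover have "coprime (b * d) (int p)" "b * d \<noteq> 0" using * by auto
  ultimately show ?thesis using p_integral_fractionI by metis
qed

lemma p_integral_mult [simp, intro]:
  assumes "x \<in> p_integral p" "y \<in> p_integral p"
  shows "x * y \<in> p_integral p"
proof -
  obtain a b c d where *: "coprime b (int p)" "b > 0" "x = of_int a / of_int b"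
    "coprime d (int p)" "d > 0" "y = of_int c / of_int d"
    using assms by (elim p_integralE)
  hence "x * y = of_int (a * c) / of_int (b * d)" by simp
  moreover have "coprime (b * d) (int p)" "b * d \<noteq> 0" using * by auto
  ultimately show ?thesis using p_integral_fractionI by metis
qed

lemma p_integral_uminus [simp, intro]: "x \<in> p_integral p \<Longrightarrow> - x \<in> p_integral p"
  using p_integral_mult[of "of_int (-1)" p x, OF p_integral_of_int] by simp

lemma p_integral_diff [simp, intro]:
  "x \<in> p_integral p \<Longrightarrow> y \<in> p_integral p \<Longrightarrow> x - y \<in> p_integral p"
  using p_integral_add[of x p "- y"] by simp

lemma p_integral_power [simp, intro]: "x \<in> p_integral p \<Longrightarrow> x ^ k \<in> p_integral p"
  by (induction k) auto

lemma p_integral_sum [intro]: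
  "(\<And>i. i \<in> S \<Longrightarrow> f i \<in> p_integral p) \<Longrightarrow> sum f S \<in> p_integral p"
  by (induction S rule: infinite_finite_induct) auto

lemma p_integral_divide_of_nat:
  assumes "prime p" "\<not> p dvd j" "x \<in> p_integral p"
  shows "x / of_nat j \<in> p_integral p"
proof -
  have "coprime (int j) (int p)"
    using prime_imp_coprime[OF assms(1,2)] by (simp add: coprime_commute)
  moreover have "j \<noteq> 0" using assms(2) by (intro notI) simp
  ultimately have "of_int 1 / of_int (int j) \<in> p_integral p"
    by (intro p_integral_fractionI) auto
  from p_integral_mult[OF assms(3) this] show ?thesis by simp
qed

lemma rat_congE:
  assumes "rat_cong p m a b" "p > 0"
  obtains c where "c \<in> p_integral p" "a = b + of_nat p ^ m * c"
  by (rule that[of "(a - b) / of_nat p ^ m"]) (use assms in \<open>auto simp: rat_cong_iff_p_integral\<close>)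

lemma rat_congI:
  assumes "c \<in> p_integral p" "a = b + of_nat p ^ m * c" "p > 0"
  shows "rat_cong p m a b"
  using assms by (simp add: rat_cong_iff_p_integral)

lemma rat_cong_refl [simp, intro]: "rat_cong p m a a"
  by (simp add: rat_cong_iff_p_integral)

lemma rat_cong_sym: "rat_cong p m a b \<Longrightarrow> rat_cong p m b a"
  using p_integral_uminus[of "(a - b) / of_nat p ^ m" p]
  unfolding rat_cong_iff_p_integral minus_divide_left minus_diff_eq .

lemma rat_cong_add:
  "rat_cong p m a b \<Longrightarrow> rat_cong p m c d \<Longrightarrow> rat_cong p m (a + c) (b + d)"
  using p_integral_add[of "(a - b) / of_nat p ^ m" p "(c - d) / of_nat p ^ m"]
  by (simp add: rat_cong_iff_p_integral add_diff_add flip: add_divide_distrib)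

text \<open>A congruence between \<open>x\<close> and \<open>y\<close> follows from any congruence whose
  difference is proportional to \<open>x - y\<close>. In this form all rearrangements are left to a single ring
  identity.\<close>

lemma rat_cong_scale:
  assumes "rat_cong p m a b" "c \<in> p_integral p" "x - y = c * (a - b)"
  shows "rat_cong p m x y"
  using p_integral_mult[OF assms(2) assms(1)[unfolded rat_cong_iff_p_integral]] assms(3)
  by (simp add: rat_cong_iff_p_integral)

lemma rat_cong_trans [trans]:
  "rat_cong p m a b \<Longrightarrow> rat_cong p m b c \<Longrightarrow> rat_cong p m a c"
  using rat_cong_add[of p m a b b c] by (auto simp: rat_cong_iff_p_integral)

lemma rat_cong_sum:
  "(\<And>i. i \<in> S \<Longrightarrow> rat_cong p m (f i) (g i)) \<Longrightarrow> rat_cong p m (sum f S) (sum g S)"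
  by (induction S rule: infinite_finite_induct) (auto intro: rat_cong_add)

text \<open>As \<open>rat_cong_scale\<close>, but a factor \<open>p\<close> in the multiplier raises the
  modulus.\<close>

lemma rat_cong_shift:
  assumes "rat_cong p m a b" "c \<in> p_integral p" "x - y = of_nat p ^ (k - m) * c * (a - b)" "p > 0" "m \<le> k"
  shows "rat_cong p k x y"
proof -
  obtain d where d: "d \<in> p_integral p" "a = b + of_nat p ^ m * d" using rat_congE[OF assms(1,4)] .
  show ?thesis
    by (rule rat_congI[of "c * d"])
      (use assms d in \<open>auto simp: algebra_simps simp flip: power_add\<close>)
qed

lemma rat_cong_weaken:
  assumes "rat_cong p m a b" "l \<le> m" "p > 0"
  shows "rat_cong p l a b"
proof -
  obtain d where d: "d \<in> p_integral p" "a = b + of_nat p ^ m * d" using rat_congE[OF assms(1,3)] .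
  show ?thesis
    by (rule rat_congI[of "of_nat p ^ (m - l) * d"])
      (use assms d in \<open>auto simp flip: power_add mult.assoc\<close>)
qed

lemma rat_cong_of_int:
  assumes "[a = b] (mod int p)"
  shows "rat_cong p 1 (of_int a) (of_int b)"
proof (cases "p = 0")
  case True
  with assms show ?thesis by simp
next
  case False
  obtain c where "a - b = int p * c" using assms by (metis cong_iff_dvd_diff dvdE)
  hence "of_int (a - b) = (of_nat p * of_int c :: rat)" by simp
  thus ?thesis using False by (intro rat_congI[of "of_int c"]) (auto simp: algebra_simps)
qed

lemma rat_cong_prod_first_order:
  assumes "\<And>i. i \<in> S \<Longrightarrow> x i \<in> p_integral p" "p > 0"
  shows "rat_cong p (2 * l) (\<Prod>i\<in>S. 1 + of_nat p ^ l * x i) (1 + of_nat p ^ l * (\<Sum>i\<in>S. x i))"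
  using assms(1)
proof (induction S rule: infinite_finite_induct)
  case (insert i S)
  have "rat_cong p (2 * l) (\<Prod>i\<in>S. 1 + of_nat p ^ l * x i) (1 + of_nat p ^ l * (\<Sum>i\<in>S. x i))"
    by (rule insert.IH) (use insert.prems in auto)
  from rat_congE[OF this assms(2)] obtain c where c: "c \<in> p_integral p"
    "(\<Prod>i\<in>S. 1 + of_nat p ^ l * x i) = 1 + of_nat p ^ l * (\<Sum>i\<in>S. x i) + of_nat p ^ (2 * l) * c"
    by blast
  have [simp]: "x i \<in> p_integral p" "sum x S \<in> p_integral p" using insert by auto
  show ?case
    by (rule rat_congI[of "x i * sum x S + (1 + of_nat p ^ l * x i) * c"])
      (use c insert assms in \<open>auto simp: algebra_simps power_add power_mult power2_eq_square\<close>)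
qed auto

text \<open>The second elementary symmetric function is \<open>((\<Sum>x)\<^sup>2 - \<Sum>x\<^sup>2) /
  2\<close>, and those of higher degree carry a factor \<open>p ^ 3\<close>.\<close>

lemma rat_cong_prod_second_order:
  assumes "\<And>i. i \<in> S \<Longrightarrow> x i \<in> p_integral p" "prime p" "odd p"
  shows "rat_cong p 3 (\<Prod>i\<in>S. 1 + of_nat p * x i)
     (1 + of_nat p * (\<Sum>i\<in>S. x i) + of_nat p ^ 2 * (((\<Sum>i\<in>S. x i) ^ 2 - (\<Sum>i\<in>S. x i ^ 2)) / 2))"
  using assms(1)
proof (induction S rule: infinite_finite_induct)
  case (insert i S)
  define s e where "s = (\<Sum>i\<in>S. x i)" and "e = ((\<Sum>i\<in>S. x i) ^ 2 - (\<Sum>i\<in>S. x i ^ 2)) / 2"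
  have p0: "p > 0" using assms(2) by (simp add: prime_gt_0_nat)
  have "rat_cong p 3 (\<Prod>i\<in>S. 1 + of_nat p * x i) (1 + of_nat p * s + of_nat p ^ 2 * e)"
    unfolding s_def e_def by (rule insert.IH) (use insert.prems in auto)
  from rat_congE[OF this p0] obtain c where c: "c \<in> p_integral p"
    "(\<Prod>i\<in>S. 1 + of_nat p * x i) = 1 + of_nat p * s + of_nat p ^ 2 * e + of_nat p ^ 3 * c"
    by blast
  have [simp]: "x i \<in> p_integral p" "sum x S \<in> p_integral p" "(\<Sum>i\<in>S. x i ^ 2) \<in> p_integral p"
    using insert by auto
  have "\<not> p dvd 2" using assms(2,3) by (metis dvd_refl primes_dvd_imp_eq two_is_prime_nat)
  hence [simp]: "e \<in> p_integral p"
    using p_integral_divide_of_nat[of p 2 "(\<Sum>i\<in>S. x i) ^ 2 - (\<Sum>i\<in>S. x i ^ 2)"] assms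
    by (auto simp: e_def)
  have e': "((\<Sum>i\<in>insert i S. x i) ^ 2 - (\<Sum>i\<in>insert i S. x i ^ 2)) / 2 = e + x i * s"
    using insert by (simp add: e_def s_def power2_eq_square field_simps)
  show ?case unfolding e'
    by (rule rat_congI[of "x i * e + (1 + of_nat p * x i) * c"])
      (use c insert p0 in \<open>auto simp: algebra_simps power2_eq_square power3_eq_cube s_def[symmetric]\<close>)
qed auto

section \<open>Appell polynomials, Bernoulli and Euler numbers\<close>

text \<open>For \<open>a = bernoulli\<close> this is the \<open>m\<close>-th Bernoulli polynomial; for \<open>a
  = euler_number\<close> it is \<open>2 ^ m * E ((x + 1) / 2)\<close> for the \<open>m\<close>-th Euler
  polynomial \<open>E\<close>, a polynomial in \<open>x\<close> with integer coefficients.\<close>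

definition appell :: "(nat \<Rightarrow> 'a) \<Rightarrow> nat \<Rightarrow> 'a \<Rightarrow> 'a :: comm_ring_1" where
  "appell a m x = (\<Sum>j\<le>m. of_nat (m choose j) * a j * x ^ (m - j))"

text \<open>With generating function \<open>A(t) e\<^bsup>xt\<^esup>\<close> in mind, this is \<open>A(t)
  e\<^bsup>yt\<^esup> e\<^bsup>xt\<^esup>\<close>. It reduces difference equations in \<open>x\<close> to values
  at the single point \<open>y\<close>, where the defining recurrences give them.\<close>

lemma appell_add:
  "appell a m (x + y) = (\<Sum>s\<le>m. of_nat (m choose s) * appell a s y * x ^ (m - s))"
proof -
  define f where "f j i = of_nat ((m choose j) * ((m - j) choose i)) * a j * y ^ i * x ^ (m - j - i)"
    for j i
  have "appell a m (x + y) = (\<Sum>j\<le>m. \<Sum>i\<le>m - j. f j i)"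
    unfolding appell_def f_def add.commute[of x y] binomial_ring
    by (simp add: sum_distrib_left mult_ac)
  also have "\<dots> = (\<Sum>(j,i)\<in>{(j,i). j + i \<le> m}. f j i)"
    by (subst sum.Sigma) (auto intro!: sum.cong)
  also have "\<dots> = (\<Sum>s\<le>m. \<Sum>j\<le>s. f j (s - j))"
    by (rule sum.triangle_reindex_eq)
  also have "\<dots> = (\<Sum>s\<le>m. of_nat (m choose s) * appell a s y * x ^ (m - s))"
  proof (rule sum.cong[OF refl])
    fix s assume s: "s \<in> {..m}"
    have "f j (s - j) = of_nat (m choose s) * (of_nat (s choose j) * a j * y ^ (s - j)) * x ^ (m - s)"
      if "j \<le> s" for j
    proof -
      have *: "(m choose j) * ((m - j) choose (s - j)) = (m choose s) * (s choose j)" "m - j - (s - j) = m - s"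
        using choose_mult[of j s m] that s by auto
      show ?thesis unfolding f_def * of_nat_mult by (simp only: mult_ac)
    qed
    thus "(\<Sum>j\<le>s. f j (s - j)) = of_nat (m choose s) * appell a s y * x ^ (m - s)"
      by (simp add: appell_def sum_distrib_left sum_distrib_right)
  qed
  finally show ?thesis .
qed

lemma appell_0: "appell a m 0 = a m"
proof -
  have "appell a m 0 = (\<Sum>j\<le>m. if j = m then a m else 0)"
    unfolding appell_def by (rule sum.cong) (auto simp: power_0_left)
  thus ?thesis by simp
qed

lemma appell_bernoulli_1: "appell bernoulli m 1 = bernoulli m + (if m = 1 then 1 else 0)"
proof (cases m)
  case (Suc k)
  have "appell bernoulli m 1 = (\<Sum>j=0..k. of_nat ((k + 1) choose j) * bernoulli j) + bernoulli m"
    by (simp add: appell_def Suc atLeast0AtMost)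
  thus ?thesis
    using bernoulli_recurrence[of k] Suc by (cases k) (auto simp: bernoulli_0)
qed (simp add: appell_def)

lemma appell_bernoulli_step:
  "appell bernoulli (Suc m) (x + 1) = appell bernoulli (Suc m) x + of_nat (Suc m) * x ^ m"
proof -
  have "appell bernoulli (Suc m) (x + 1) - appell bernoulli (Suc m) (x + 0) =
    (\<Sum>s\<le>Suc m. of_nat (Suc m choose s) * (appell bernoulli s 1 - appell bernoulli s 0) * x ^ (Suc m - s))"
    unfolding appell_add by (simp only: sum_subtractf algebra_simps)
  also have "\<dots> = (\<Sum>s\<le>Suc m. if s = 1 then of_nat (Suc m) * x ^ m else 0)"
    by (rule sum.cong) (auto simp: appell_0 appell_bernoulli_1)
  also have "\<dots> = of_nat (Suc m) * x ^ m" by (subst sum.delta) auto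
  finally show ?thesis by (simp add: algebra_simps)
qed

lemma faulhaber:
  "of_nat (Suc m) * (\<Sum>j<N. of_nat j ^ m) = appell bernoulli (Suc m) (of_nat N) - bernoulli (Suc m)"
proof (induction N)
  case (Suc N)
  thus ?case using appell_bernoulli_step[of m "of_nat N"] by (simp add: algebra_simps)
qed (simp add: appell_0)

text \<open>The recurrence divides by \<open>k + 1\<close> only, so the prime \<open>p\<close> cannot enter a
  denominator before the index \<open>p - 1\<close>.\<close>

lemma bernoulli_p_integral:
  assumes "prime p" "k + 1 < p"
  shows "bernoulli k \<in> p_integral p"
  using assms(2)
proof (induction k rule: less_induct)
  case (less k)
  have "\<not> p dvd k + 1" using less.prems by (auto dest: dvd_imp_le)
  hence "- (\<Sum>i\<in>{..<k}. of_nat ((k + 1) choose i) * bernoulli i) / of_nat (k + 1) \<in> p_integral p"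
    by (intro p_integral_divide_of_nat assms p_integral_uminus p_integral_sum p_integral_mult
        less.IH p_integral_of_nat) (use less.prems in auto)
  thus ?case using bernoulli.simps[of k] by (cases "k = 0") simp_all
qed

text \<open>In Faulhaber's formula only the linear term in \<open>p\<close> survives modulo
  \<open>p\<^sup>2\<close>, since all Bernoulli numbers that occur are integral at \<open>p\<close>.\<close>

lemma power_sum_cong_bernoulli:
  assumes "prime p" "m \<ge> 1" "m + 2 < p"
  shows "rat_cong p 2 (\<Sum>j<p. of_nat j ^ m) (of_nat p * bernoulli m)"
proof -
  define c where "c = (\<Sum>k<m. of_nat (Suc m choose k) * bernoulli k * of_nat p ^ (m - 1 - k))"
  have c: "c \<in> p_integral p"
    unfolding c_def using assms by (auto intro!: p_integral_sum p_integral_mult bernoulli_p_integral)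
  have [simp]: "p > 0" using assms by simp
  have "of_nat (Suc m) * (\<Sum>j<p. of_nat j ^ m) =
     (\<Sum>k\<le>m. of_nat (Suc m choose k) * bernoulli k * of_nat p ^ (Suc m - k))"
    unfolding faulhaber by (simp add: appell_def)
  also have "\<dots> = (\<Sum>k<m. of_nat (Suc m choose k) * bernoulli k * of_nat p ^ (Suc m - k))
      + of_nat (Suc m) * bernoulli m * of_nat p"
    by (simp add: lessThan_Suc_atMost[symmetric] del: of_nat_Suc)
  also have "(\<Sum>k<m. of_nat (Suc m choose k) * bernoulli k * of_nat p ^ (Suc m - k)) = of_nat p ^ 2 * c"
    unfolding c_def sum_distrib_left
  proof (rule sum.cong[OF refl])
    fix k assume "k \<in> {..<m}"
    hence "Suc m - k = 2 + (m - 1 - k)" by auto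
    thus "of_nat (Suc m choose k) * bernoulli k * of_nat p ^ (Suc m - k) =
      (of_nat p)\<^sup>2 * (of_nat (Suc m choose k) * bernoulli k * of_nat p ^ (m - 1 - k))"
      by (simp only: power_add mult_ac)
  qed
  finally have "(\<Sum>j<p. of_nat j ^ m) = of_nat p * bernoulli m + of_nat p ^ 2 * (c / of_nat (Suc m))"
    by (simp add: field_simps del: of_nat_Suc)
  moreover have "\<not> p dvd Suc m" using assms by (auto dest: dvd_imp_le)
  ultimately show ?thesis using assms c p_integral_divide_of_nat rat_congI \<open>p > 0\<close> by metis
qed

lemma euler_number_odd: "odd m \<Longrightarrow> euler_number m = 0"
proof (induction m rule: less_induct)
  case (less m)
  have "(\<Sum>k | 1 \<le> k \<and> k \<le> m \<and> even k. of_nat (m choose k) * euler_number (m - k)) = 0"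
    by (rule sum.neutral) (use less in auto)
  thus ?case using less.prems by (subst euler_number.simps) (auto simp: odd_pos)
qed

text \<open>Adding the values at \<open>1\<close> and \<open>-1\<close> selects the even indices that occur in
  the recurrence of the Euler numbers.\<close>

lemma appell_euler_1_plus_neg_1:
  "appell euler_number m 1 + appell euler_number m (-1) = (if m = 0 then 2 else 0)"
proof -
  have "appell euler_number m 1 + appell euler_number m (-1) =
     (\<Sum>j\<le>m. of_nat (m choose j) * euler_number j * (1 + (-1) ^ (m - j)))"
    by (simp add: appell_def algebra_simps sum.distrib)
  also have "\<dots> = (\<Sum>k\<le>m. of_nat (m choose k) * euler_number (m - k) * (1 + (-1) ^ k))"
    by (rule sum.reindex_bij_witness[of _ "\<lambda>k. m - k" "\<lambda>k. m - k"]) (auto simp flip: binomial_symmetric)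
  also have "\<dots> = (\<Sum>k\<le>m. if even k then 2 * (of_nat (m choose k) * euler_number (m - k)) else 0)"
    by (rule sum.cong) auto
  also have "\<dots> = 2 * (\<Sum>k | 0 \<le> k \<and> k \<le> m \<and> even k. of_nat (m choose k) * euler_number (m - k))"
    unfolding sum_distrib_left by (subst sum.inter_filter[symmetric]) (auto intro!: sum.cong)
  also have "\<dots> = (if m = 0 then 2 else 0)"
  proof (cases "m = 0")
    case True
    have "{k::nat. k = 0 \<and> even k} = {0}" by auto
    with True show ?thesis by (simp add: euler_number_0)
  qed (use euler_number_recurrence[of m] in auto)
  finally show ?thesis .
qed

text \<open>In terms of generating functions: \<open>sech t (e\<^bsup>t\<^esup> + e\<^bsup>-t\<^esup>)
  e\<^bsup>xt\<^esup> = 2 e\<^bsup>xt\<^esup>\<close>.\<close>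

lemma appell_euler_step:
  "appell euler_number m (x + 1) + appell euler_number m (x - 1) = 2 * x ^ m"
proof -
  have "appell euler_number m (x + 1) + appell euler_number m (x + (-1)) =
    (\<Sum>s\<le>m. of_nat (m choose s) * (appell euler_number s 1 + appell euler_number s (-1)) * x ^ (m - s))"
    unfolding appell_add by (simp only: sum.distrib algebra_simps)
  also have "\<dots> = (\<Sum>s\<le>m. if s = 0 then 2 * x ^ m else 0)"
    by (rule sum.cong) (auto simp: appell_euler_1_plus_neg_1)
  also have "\<dots> = 2 * x ^ m" by simp
  finally show ?thesis by simp
qed

text \<open>For even \<open>m\<close> the polynomial is even because odd Euler numbers vanish, so its values at
  \<open>1\<close> and \<open>-1\<close> agree; their sum is zero.\<close>

lemma appell_euler_neg_1:
  assumes "even m" "m > 0"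
  shows "appell euler_number m (-1) = 0"
proof -
  have "appell euler_number m (-1) = appell euler_number m 1"
    unfolding appell_def
    by (rule sum.cong) (use assms in \<open>auto simp: euler_number_odd minus_one_power_iff\<close>)
  thus ?thesis using appell_euler_1_plus_neg_1[of m] assms by simp
qed

lemma alternating_odd_power_sum:
  "2 * (\<Sum>k<N. (-1) ^ k * int (2 * k + 1) ^ m) =
     euler_number m - (-1) ^ N * appell euler_number m (int (2 * N))"
proof (induction N)
  case (Suc N)
  have *: "appell euler_number m (int (2 * N)) =
      2 * int (2 * N + 1) ^ m - appell euler_number m (int (2 * Suc N))"
    using appell_euler_step[of m "int (2 * N + 1)"] by (simp add: algebra_simps)
  show ?case unfolding sum.lessThan_Suc distrib_left Suc.IH * by (simp add: algebra_simps)
qed (simp add: appell_0)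

text \<open>The endpoint \<open>2 n = p - 1\<close> of the telescoping sum is congruent to \<open>-1\<close>, a
  zero of the polynomial.\<close>

lemma alternating_odd_power_sum_cong_euler:
  assumes "even m" "m > 0" "p = 2 * n + 1"
  shows "[2 * (\<Sum>k<n. (-1) ^ k * int (2 * k + 1) ^ m) = euler_number m] (mod int p)"
proof -
  have "[int (2 * n) = -1] (mod int p)" using assms(3) by (simp add: cong_iff_dvd_diff add.commute)
  hence "[appell euler_number m (int (2 * n)) = appell euler_number m (-1)] (mod int p)"
    unfolding appell_def by (intro cong_sum cong_mult cong_pow cong_refl)
  hence "[euler_number m - (-1) ^ n * appell euler_number m (int (2 * n)) =
      euler_number m - (-1) ^ n * 0] (mod int p)"
    using appell_euler_neg_1[OF assms(1,2)] by (intro cong_diff cong_mult cong_refl) simp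
  thus ?thesis unfolding alternating_odd_power_sum by simp
qed

section \<open>Exact evaluation of the three sums\<close>

lemma sum_central_binomial:
  "(\<Sum>n<N. of_nat ((n + k) choose (2 * k))) = (of_nat ((N + k) choose (2 * k + 1)) :: rat)"
  by (induction N) simp_all

text \<open>The recurrence that drives both weighted telescopings below. Over the rationals it holds for all
  \<open>k\<close>, without truncated subtraction.\<close>

lemma binomial_step_rat:
  "(of_nat N + of_nat k + 1) * of_nat ((N + k) choose (2 * k)) =
   (of_nat N + 1 - of_nat k) * (of_nat ((Suc N + k) choose (2 * k)) :: rat)"
proof (cases "2 * k \<le> N + k")
  case True
  have "Suc (N + k) * ((N + k) choose (2 * k)) = (Suc (N + k) - 2 * k) * (Suc (N + k) choose (2 * k))"
    using binomial_absorb_comp[of "Suc (N + k)" "2 * k"] by simp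
  hence "of_nat (Suc (N + k) * ((N + k) choose (2 * k))) =
      (of_nat ((Suc (N + k) - 2 * k) * (Suc (N + k) choose (2 * k))) :: rat)" by (rule arg_cong)
  moreover have "2 * k \<le> Suc (N + k)" using True by simp
  ultimately show ?thesis
    unfolding of_nat_mult of_nat_diff[OF \<open>2 * k \<le> Suc (N + k)\<close>] by (simp add: algebra_simps)
next
  case False
  thus ?thesis by (cases "k = Suc N") (simp_all add: binomial_eq_0)
qed

lemma sum_alternating_weighted_central_binomial:
  "(\<Sum>n<N. (2 * of_nat n + 1) * (-1) ^ n * of_nat ((n + k) choose (2 * k))) =
     - ((-1) ^ N) * (of_nat N - of_nat k) * (of_nat ((N + k) choose (2 * k)) :: rat)"
proof (induction N)
  case 0
  show ?case by (cases k) (auto simp: binomial_eq_0)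
next
  case (Suc N)
  have "(\<Sum>n<Suc N. (2 * of_nat n + 1) * (-1) ^ n * of_nat ((n + k) choose (2 * k))) =
    (-1) ^ N * ((of_nat N + of_nat k + 1) * (of_nat ((N + k) choose (2 * k)) :: rat))"
    unfolding sum.lessThan_Suc Suc.IH by (simp add: algebra_simps)
  thus ?case unfolding binomial_step_rat by (simp add: algebra_simps)
qed

lemma sum_weighted_central_binomial:
  "(\<Sum>n<N. (2 * of_nat n + 1) * of_nat ((n + k) choose (2 * k))) =
     of_nat N / of_nat (k + 1) * (of_nat N - of_nat k) * (of_nat ((N + k) choose (2 * k)) :: rat)"
proof (induction N)
  case (Suc N)
  have *: "a / (b + 1) * (a - b) * c + (2 * a + 1) * c = (a + 1) / (b + 1) * ((a + b + 1) * c)"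
    if "b + 1 \<noteq> 0" for a b c :: rat
    using that by (simp add: divide_simps) (simp add: algebra_simps)
  have "(\<Sum>n<Suc N. (2 * of_nat n + 1) * of_nat ((n + k) choose (2 * k))) =
     of_nat (Suc N) / of_nat (k + 1) *
       ((of_nat N + of_nat k + 1) * (of_nat ((N + k) choose (2 * k)) :: rat))"
    unfolding sum.lessThan_Suc Suc.IH
    using *[of "of_nat k" "of_nat N" "of_nat ((N + k) choose (2 * k))"]
    by (simp add: add.commute[of 1])
  thus ?case unfolding binomial_step_rat by (simp add: add.commute[of 1])
qed simp

text \<open>The partial products of Euler's product for \<open>sin (pi x) / (pi x)\<close> at the integer
  \<open>x = N\<close>.\<close>

definition sine_prod :: "nat \<Rightarrow> nat \<Rightarrow> rat" where
  "sine_prod N k = (\<Prod>j=1..k. 1 - of_nat N ^ 2 / of_nat j ^ 2)"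

text \<open>Both sides have the same ratio of consecutive terms: \<open>(N - k - 1) (N + k + 1) / (k +
  1)\<^sup>2 = - (1 - N\<^sup>2 / (k + 1)\<^sup>2)\<close>.\<close>

lemma delannoy_term_eq_sine_prod:
  "(of_nat N - of_nat k) * of_nat (((N + k) choose (2 * k)) * ((2 * k) choose k)) =
     of_nat N * (-1) ^ k * sine_prod N k"
proof -
  have G: "((N + k) choose (2 * k)) * ((2 * k) choose k) = (N choose k) * ((N + k) choose k)" for k
  proof (cases "k \<le> N")
    case True
    thus ?thesis using choose_mult[of k "2 * k" "N + k"] by (simp add: mult.commute)
  qed (auto simp: binomial_eq_0)
  have "(of_nat N - of_nat k) * of_nat ((N choose k) * ((N + k) choose k)) =
     of_nat N * (-1) ^ k * sine_prod N k"
  proof (induction k)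
    case (Suc k)
    have 1: "of_nat (Suc k) * of_nat (N choose Suc k) = (of_nat N - of_nat k) * (of_nat (N choose k) :: rat)"
    proof (cases "k \<le> N")
      case True
      have "Suc k * (N choose Suc k) = (N - k) * (N choose k)"
        by (simp only: binomial_absorption binomial_absorb_comp)
      hence "of_nat (Suc k * (N choose Suc k)) = (of_nat ((N - k) * (N choose k)) :: rat)" by (rule arg_cong)
      thus ?thesis using True by (simp only: of_nat_mult of_nat_diff)
    qed (auto simp: binomial_eq_0)
    have "of_nat (Suc k * (Suc (N + k) choose Suc k)) = (of_nat (Suc (N + k) * ((N + k) choose k)) :: rat)"
      by (rule arg_cong[OF Suc_times_binomial])
    hence 2: "of_nat (Suc k) * of_nat ((N + Suc k) choose Suc k) =
        (of_nat N + of_nat k + 1) * (of_nat ((N + k) choose k) :: rat)"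
      by (simp add: algebra_simps)
    have "of_nat (Suc k) ^ 2 * ((of_nat N - of_nat (Suc k)) *
         of_nat ((N choose Suc k) * ((N + Suc k) choose Suc k)))
      = (of_nat N - of_nat (Suc k)) * (of_nat (Suc k) * of_nat (N choose Suc k)) *
        (of_nat (Suc k) * of_nat ((N + Suc k) choose Suc k) :: rat)"
      by (simp only: of_nat_mult power2_eq_square mult_ac)
    also have "\<dots> = (of_nat N ^ 2 - of_nat (Suc k) ^ 2) *
        ((of_nat N - of_nat k) * of_nat ((N choose k) * ((N + k) choose k)))"
      unfolding 1 2 by (simp add: power2_eq_square algebra_simps)
    also have "\<dots> = of_nat (Suc k) ^ 2 * (of_nat N * (-1) ^ Suc k * sine_prod N (Suc k))"
      unfolding Suc.IH sine_prod_def by (simp add: field_simps)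
    finally show ?case
      by (simp only: mult_cancel_left) simp
  qed (simp add: sine_prod_def)
  thus ?thesis unfolding G .
qed

lemma sum_delannoy_swap:
  fixes c :: "nat \<Rightarrow> rat"
  shows "(\<Sum>n<N. c n * of_nat (delannoy n)) =
    (\<Sum>k<N. of_nat ((2 * k) choose k) * (\<Sum>n<N. c n * of_nat ((n + k) choose (2 * k))))"
proof -
  have D: "of_nat (delannoy n) = (\<Sum>k<N. of_nat (((n + k) choose (2 * k)) * ((2 * k) choose k)) :: rat)"
    if "n < N" for n
  proof -
    have "delannoy n = (\<Sum>k<N. ((n + k) choose (2 * k)) * ((2 * k) choose k))"
      unfolding delannoy_def
      by (rule sum.mono_neutral_left) (use that in \<open>auto simp: binomial_eq_0\<close>)
    thus ?thesis by (simp only: of_nat_sum)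
  qed
  have "(\<Sum>n<N. c n * of_nat (delannoy n)) =
     (\<Sum>n<N. \<Sum>k<N. c n * of_nat (((n + k) choose (2 * k)) * ((2 * k) choose k)))"
    by (rule sum.cong) (auto simp: D sum_distrib_left)
  also have "\<dots> = (\<Sum>k<N. \<Sum>n<N. c n * of_nat (((n + k) choose (2 * k)) * ((2 * k) choose k)))"
    by (rule sum.swap)
  also have "\<dots> = (\<Sum>k<N. of_nat ((2 * k) choose k) * (\<Sum>n<N. c n * of_nat ((n + k) choose (2 * k))))"
    by (simp add: sum_distrib_left mult_ac)
  finally show ?thesis .
qed

lemma sum_delannoy:
  "(\<Sum>n<N. of_nat (delannoy n)) = (\<Sum>k<N. of_nat N * (-1) ^ k * sine_prod N k / of_nat (2 * k + 1))"
proof -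
  have "of_nat ((2 * k) choose k) * of_nat ((N + k) choose (2 * k + 1)) =
      of_nat N * (-1) ^ k * sine_prod N k / of_nat (2 * k + 1)" if "k < N" for k
  proof -
    have "(2 * k + 1) * ((N + k) choose (2 * k + 1)) = (N - k) * ((N + k) choose (2 * k))"
      using binomial_absorption[of "2 * k" "N + k"] binomial_absorb_comp[of "N + k" "2 * k"] that
      by simp
    hence "of_nat (2 * k + 1) * (of_nat ((N + k) choose (2 * k + 1)) :: rat) =
       of_nat (N - k) * of_nat ((N + k) choose (2 * k))" by (metis of_nat_mult)
    hence "of_nat (2 * k + 1) * (of_nat ((2 * k) choose k) * (of_nat ((N + k) choose (2 * k + 1)) :: rat)) =
       (of_nat N - of_nat k) * of_nat (((N + k) choose (2 * k)) * ((2 * k) choose k))"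
      using that by (simp add: of_nat_diff mult_ac)
    thus ?thesis unfolding delannoy_term_eq_sine_prod by (simp add: field_simps)
  qed
  thus ?thesis
    using sum_delannoy_swap[of "\<lambda>_. 1" N] by (simp add: sum_central_binomial)
qed

lemma sum_alternating_weighted_delannoy:
  assumes "odd N"
  shows "(\<Sum>n<N. (2 * of_nat n + 1) * (-1) ^ n * of_nat (delannoy n)) =
    (\<Sum>k<N. of_nat N * (-1) ^ k * sine_prod N k)"
  unfolding sum_delannoy_swap sum_alternating_weighted_central_binomial
    delannoy_term_eq_sine_prod[symmetric]
  using assms by (simp add: mult_ac)

lemma sum_weighted_delannoy:
  "(\<Sum>n<N. (2 * of_nat n + 1) * of_nat (delannoy n)) =
    (\<Sum>k<N. of_nat N ^ 2 * (-1) ^ k * sine_prod N k / of_nat (k + 1))"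
proof -
  have "of_nat N ^ 2 * (-1) ^ k * sine_prod N k / of_nat (k + 1) = of_nat N / of_nat (k + 1) *
      ((of_nat N - of_nat k) * of_nat (((N + k) choose (2 * k)) * ((2 * k) choose k)))" for k
    unfolding delannoy_term_eq_sine_prod by (simp add: power2_eq_square)
  thus ?thesis
    unfolding sum_delannoy_swap sum_weighted_central_binomial by (simp add: mult_ac)
qed


section \<open>Half-range harmonic sums modulo powers of a prime\<close>

definition gen_harmonic :: "nat \<Rightarrow> nat \<Rightarrow> rat" where
  "gen_harmonic N s = (\<Sum>j=1..N. 1 / of_nat j ^ s)"

text \<open>The two ways of covering \<open>{1..2n}\<close> by pairs with sum \<open>2n + 1\<close>: the smaller
  member ranges over \<open>{1..n}\<close>, or the even member ranges over the doubles of \<open>{1..n}\<close>.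
  They are needed for sums and for products.\<close>

lemma (in comm_monoid_set) pair_halves:
  fixes n :: nat
  shows "F g {1..2 * n} = F (\<lambda>j. g j \<^bold>* g (2 * n + 1 - j)) {1..n}"
proof -
  have "{1..2 * n} = {1..n} \<union> {n+1..2 * n}" by auto
  hence "F g {1..2 * n} = F g {1..n} \<^bold>* F g {n+1..2 * n}"
    by (simp add: union_disjoint)
  also have "F g {n+1..2 * n} = F (\<lambda>j. g (2 * n + 1 - j)) {1..n}"
    by (rule reindex_bij_witness[of _ "\<lambda>j. 2 * n + 1 - j" "\<lambda>j. 2 * n + 1 - j"]) auto
  finally show ?thesis by (simp add: distrib)
qed

lemma (in comm_monoid_set) pair_parity:
  fixes n :: nat
  shows "F g {1..2 * n} = F (\<lambda>i. g (2 * i) \<^bold>* g (2 * n + 1 - 2 * i)) {1..n}"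
proof -
  have *: "{j \<in> {1..2 * n}. even j} \<union> {j \<in> {1..2 * n}. odd j} = {1..2 * n}" by auto
  have "F g ({j \<in> {1..2 * n}. even j} \<union> {j \<in> {1..2 * n}. odd j}) =
      F g {j \<in> {1..2 * n}. even j} \<^bold>* F g {j \<in> {1..2 * n}. odd j}"
    by (rule union_disjoint) auto
  hence "F g {1..2 * n} = F g {j \<in> {1..2 * n}. even j} \<^bold>* F g {j \<in> {1..2 * n}. odd j}"
    unfolding * .
  also have "F g {j \<in> {1..2 * n}. even j} = F (\<lambda>i. g (2 * i)) {1..n}"
    by (rule reindex_bij_witness[of _ "\<lambda>i. 2 * i" "\<lambda>j. j div 2"]) auto
  also have "F g {j \<in> {1..2 * n}. odd j} = F (\<lambda>i. g (2 * n + 1 - 2 * i)) {1..n}"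
    by (rule reindex_bij_witness[of _ "\<lambda>i. 2 * n + 1 - 2 * i" "\<lambda>j. n - j div 2"])
      (auto elim!: oddE intro!: arg_cong[of _ _ g])
  finally show ?thesis by (simp add: distrib)
qed

text \<open>Both sides come from \<open>(2 n)!\<close>: it is the product of \<open>j (p - j)\<close> and also
  of \<open>2 j (p - 2 j)\<close>, for \<open>j \<le> n\<close> and \<open>p = 2 n + 1\<close>; these are
  \<open>- j\<^sup>2\<close> and \<open>- 4 j\<^sup>2\<close> times the factors of the statement.\<close>

lemma prod_one_minus_div_duplication:
  "(\<Prod>j=1..n. 1 - of_nat (2 * n + 1) / of_nat j) =
     (2 ^ (2 * n) * (\<Prod>j=1..n. 1 - of_nat (2 * n + 1) / (2 * of_nat j)) :: rat)"
proof -
  let ?p = "of_nat (2 * n + 1) :: rat" and ?z = "\<Prod>j=1..n. - (of_nat j ^ 2) :: rat"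
  have "(\<Prod>j=1..2*n. of_nat j :: rat) = (\<Prod>j=1..n. (1 - ?p / of_nat j) * - (of_nat j ^ 2))"
    unfolding prod.pair_halves
    by (rule prod.cong) (auto simp: of_nat_diff field_simps power2_eq_square)
  also have "\<dots> = (\<Prod>j=1..n. 1 - ?p / of_nat j) * ?z" by (rule prod.distrib)
  finally have 1: "(\<Prod>j=1..2*n. of_nat j :: rat) = \<dots>" .
  have "(\<Prod>j=1..2*n. of_nat j :: rat) = (\<Prod>j=1..n. 4 * (1 - ?p / (2 * of_nat j)) * - (of_nat j ^ 2))"
    unfolding prod.pair_parity
    by (rule prod.cong) (auto simp: of_nat_diff field_simps power2_eq_square)
  also have "\<dots> = 4 ^ n * (\<Prod>j=1..n. 1 - ?p / (2 * of_nat j)) * ?z"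
    by (simp only: prod.distrib prod_constant card_atLeastAtMost) simp
  finally have "(\<Prod>j=1..n. 1 - ?p / of_nat j) * ?z = 4 ^ n * (\<Prod>j=1..n. 1 - ?p / (2 * of_nat j)) * ?z"
    using 1 by simp
  moreover have "?z \<noteq> 0" by simp
  moreover have "(4::rat) ^ n = 2 ^ (2 * n)" by (simp add: power_mult)
  ultimately show ?thesis by (metis mult_right_cancel)
qed

lemma power_add_first_order:
  assumes "a \<in> p_integral p" "p > 0"
  shows "rat_cong p 2 ((a + of_nat p) ^ Suc m) (a ^ Suc m + of_nat (Suc m) * of_nat p * a ^ m)"
proof (induction m)
  case (Suc m)
  from rat_congE[OF this assms(2)] obtain c where c: "c \<in> p_integral p"
    "(a + of_nat p) ^ Suc m = a ^ Suc m + of_nat (Suc m) * of_nat p * a ^ m + of_nat p ^ 2 * c"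
    by blast
  show ?case unfolding power_Suc[of _ "Suc m"] c
    by (rule rat_congI[of "of_nat (Suc m) * a ^ m + (a + of_nat p) * c"])
      (use c assms in \<open>auto simp: algebra_simps power2_eq_square\<close>)
qed simp

context
  fixes p n :: nat
  assumes prime: "prime p" and p_eq: "p = 2 * n + 1" and gt3: "p > 3"
begin

lemma p_pos: "p > 0"
  using gt3 by simp

lemma n_less [simp]: "n < p" "2 * n < p"
  by (simp_all add: p_eq)

lemma not_dvd_below: "0 < j \<Longrightarrow> j < p \<Longrightarrow> \<not> p dvd j"
  by (auto dest: dvd_imp_le)

lemma p_integral_divide_power [simp, intro]:
  assumes "0 < j" "j < p" "x \<in> p_integral p"
  shows "x / of_nat j ^ s \<in> p_integral p"
  using p_integral_divide_of_nat[OF prime _ assms(3), of "j ^ s"] not_dvd_below[OF assms(1,2)] prime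
    prime_dvd_power by (metis of_nat_power)

lemma p_integral_divide_2: "x \<in> p_integral p \<Longrightarrow> x / 2 \<in> p_integral p"
  and p_integral_divide_3: "x \<in> p_integral p \<Longrightarrow> x / 3 \<in> p_integral p"
  using p_integral_divide_power[of 2 x 1] p_integral_divide_power[of 3 x 1] gt3 by auto

lemma gen_harmonic_p_integral [simp, intro]: "N < p \<Longrightarrow> gen_harmonic N s \<in> p_integral p"
  unfolding gen_harmonic_def by (intro p_integral_sum p_integral_divide_power) auto

text \<open>The full sum evaluated by its two pairings. Eliminating it gives a linear relation between the
  half-range sums of \<open>f\<close> and \<open>g\<close> when these are constant multiples of
  powers of \<open>j\<close>, because doubling \<open>j\<close> then multiplies them by different constants.\<close>

lemma rat_cong_reflection:
  assumes "\<And>j. 0 < j \<Longrightarrow> j < p \<Longrightarrow> rat_cong p 2 (f (p - j)) (f j + of_nat p * g j)"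
  shows "rat_cong p 2 (\<Sum>j=1..2*n. f j) (\<Sum>j=1..n. 2 * f j + of_nat p * g j)"
    and "rat_cong p 2 (\<Sum>j=1..2*n. f j) (\<Sum>j=1..n. 2 * f (2 * j) + of_nat p * g (2 * j))"
proof -
  have *: "rat_cong p 2 (f j + f (p - j)) (2 * f j + of_nat p * g j)" if "0 < j" "j < p" for j
    using rat_cong_add[OF rat_cong_refl assms[OF that], of "f j"] by (simp add: algebra_simps)
  show "rat_cong p 2 (\<Sum>j=1..2*n. f j) (\<Sum>j=1..n. 2 * f j + of_nat p * g j)"
    unfolding sum.pair_halves p_eq[symmetric] by (intro rat_cong_sum *) (auto simp: p_eq)
  show "rat_cong p 2 (\<Sum>j=1..2*n. f j) (\<Sum>j=1..n. 2 * f (2 * j) + of_nat p * g (2 * j))"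
    unfolding sum.pair_parity p_eq[symmetric] by (intro rat_cong_sum *) (auto simp: p_eq)
qed

text \<open>The two leading terms of the expansion of \<open>(p - j)\<^sup>-\<^sup>2\<close> in powers of
  \<open>p\<close>.\<close>

lemma inverse_square_reflection:
  assumes "0 < j" "j < p"
  shows "rat_cong p 2 (1 / of_nat (p - j) ^ 2) (1 / of_nat j ^ 2 + of_nat p * (2 / of_nat j ^ 3))"
proof (rule rat_congI)
  define a b :: rat where "a = of_nat j" and "b = of_nat (p - j)"
  have ab: "a \<noteq> 0" "b \<noteq> 0" "of_nat p = a + b" using assms by (auto simp: a_def b_def of_nat_diff)
  \<comment> \<open>the exact difference of the two sides is \<open>p\<^sup>2\<close> times this fraction\<close>
  show "(3 * a - 2 * of_nat p) / a ^ 3 / b ^ 2 \<in> p_integral p"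
    unfolding a_def b_def using assms by (intro p_integral_divide_power) auto
  have "(a + b) ^ 2 * (3 * a - 2 * (a + b)) + a * b\<^sup>2 + 2 * (a + b) * b\<^sup>2 = a ^ 3"
    by (simp add: algebra_simps power2_eq_square power3_eq_cube)
  thus "1 / of_nat (p - j) ^ 2 = 1 / of_nat j ^ 2 + of_nat p * (2 / of_nat j ^ 3)
      + of_nat p ^ 2 * ((3 * a - 2 * of_nat p) / a ^ 3 / b ^ 2)"
    using ab(1,2) unfolding a_def[symmetric] b_def[symmetric] ab(3)
    by (simp add: field_simps power2_eq_square power3_eq_cube)
qed (rule p_pos)

text \<open>The two leading terms of the expansion in powers of \<open>p\<close>, about a general multiple of
  \<open>p\<close>: the odd denominators \<open>2 k + 1\<close> of the first sum are reflected at \<open>2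
  p\<close> instead of \<open>p\<close>, which preserves oddness.\<close>

lemma inverse_reflection:
  assumes "0 < j" "j < p" "\<not> p dvd l * p - j" "j \<le> l * p"
  shows "rat_cong p 2 (1 / of_nat (l * p - j)) (- (1 / of_nat j) - of_nat (l * p) / of_nat j ^ 2)"
proof (rule rat_congI)
  define a b :: rat where "a = of_nat j" and "b = of_nat (l * p - j)"
  have "l * p - j \<noteq> 0" using assms(3) by (metis dvd_0_right)
  hence ab: "a \<noteq> 0" "b \<noteq> 0" "of_nat (l * p) = a + b"
    using assms by (auto simp: a_def b_def of_nat_diff simp del: of_nat_mult)
  show "of_nat l ^ 2 / of_nat j ^ 2 / of_nat (l * p - j) \<in> p_integral p"
    using assms by (intro p_integral_divide_power p_integral_divide_of_nat prime) auto
  have "of_nat p ^ 2 * (of_nat l ^ 2 / of_nat j ^ 2 / of_nat (l * p - j)) = of_nat (l * p) ^ 2 / a ^ 2 / b"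
    unfolding a_def b_def of_nat_mult power_mult_distrib by (simp only: times_divide_eq_right mult.commute)
  moreover have "1 / b = - (1 / a) - (a + b) / a ^ 2 + (a + b) ^ 2 / a ^ 2 / b"
    using ab(1,2) by (simp add: field_simps power2_eq_square)
  ultimately show "1 / of_nat (l * p - j) = - (1 / of_nat j) - of_nat (l * p) / of_nat j ^ 2
      + of_nat p ^ 2 * (of_nat l ^ 2 / of_nat j ^ 2 / of_nat (l * p - j) :: rat)"
    unfolding ab(3) a_def[symmetric] b_def[symmetric] by (simp only:)
qed (rule p_pos)

lemma power_reflection:
  assumes "even m" "m > 0" "0 < j" "j < p"
  shows "rat_cong p 2 (of_nat (p - j) ^ m) (of_nat j ^ m + of_nat p * (- of_nat m * of_nat j ^ (m - 1)))"
proof -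
  obtain k where k: "m = Suc k" using assms(2) gr0_implies_Suc by blast
  have 1: "(- of_nat j) ^ k = - (of_nat j ^ k :: rat)" using assms(1) k by simp
  have 2: "(- of_nat j) ^ Suc k = (of_nat j ^ Suc k :: rat)" using assms(1) k by simp
  have 3: "- of_nat j + of_nat p = (of_nat (p - j) :: rat)" using assms by (simp add: of_nat_diff)
  have "rat_cong p 2 (of_nat (p - j) ^ Suc k) (of_nat j ^ Suc k + of_nat (Suc k) * of_nat p * - (of_nat j ^ k))"
    using power_add_first_order[of "- of_nat j" p k] p_pos unfolding 1 2 3 by blast
  moreover have "of_nat (Suc k) * of_nat p * - (of_nat j ^ k) =
      of_nat p * (- of_nat (Suc k) * (of_nat j ^ (Suc k - 1) :: rat))"
    by (simp del: of_nat_Suc)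
  ultimately show ?thesis unfolding k by (simp only:)
qed

text \<open>With \<open>H2\<close> and \<open>H3\<close> the two half-range sums, the pairings give \<open>2 H2
  + 2 p H3 \<equiv> H2 / 2 + p H3 / 4\<close>.\<close>

lemma gen_harmonic_2_cong_gen_harmonic_3:
  "rat_cong p 2 (gen_harmonic n 2) (- 7 / 6 * of_nat p * gen_harmonic n 3)"
proof -
  note refl = rat_cong_reflection[of "\<lambda>j. 1 / of_nat j ^ 2" "\<lambda>j. 2 / of_nat j ^ 3",
      OF inverse_square_reflection]
  have 1: "(\<Sum>j=1..n. 2 * (1 / of_nat j ^ 2) + of_nat p * (2 / of_nat j ^ 3)) =
      2 * gen_harmonic n 2 + 2 * of_nat p * gen_harmonic n 3"
    by (simp add: gen_harmonic_def sum.distrib sum_distrib_left mult_ac)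
  have 2: "(\<Sum>j=1..n. 2 * (1 / of_nat (2 * j) ^ 2) + of_nat p * (2 / of_nat (2 * j) ^ 3)) =
      gen_harmonic n 2 / 2 + of_nat p * gen_harmonic n 3 / 4"
    by (simp add: gen_harmonic_def sum.distrib sum_distrib_left sum_divide_distrib power_mult_distrib mult_ac)
  have "rat_cong p 2 (2 * gen_harmonic n 2 + 2 * of_nat p * gen_harmonic n 3) (gen_harmonic n 2 / 2 + of_nat p * gen_harmonic n 3 / 4)"
    using rat_cong_trans[OF rat_cong_sym[OF refl(1)] refl(2)] unfolding 1 2 by simp
  thus ?thesis
    by (rule rat_cong_scale[of _ _ _ _ "2 / 3"]) (auto intro: p_integral_divide_3 simp: field_simps)
qed

lemma gen_harmonic_2_cong_0: "rat_cong p 1 (gen_harmonic n 2) 0"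
  and gen_harmonic_2_full_cong_0: "rat_cong p 1 (gen_harmonic (2 * n) 2) 0"
proof -
  have i: "gen_harmonic n 3 \<in> p_integral p" by simp
  have "rat_cong p 1 (- 7 / 6 * of_nat p * gen_harmonic n 3) 0"
    by (rule rat_congI[of "- 7 / 2 / 3 * gen_harmonic n 3"])
      (use i p_pos in \<open>auto intro!: p_integral_mult p_integral_divide_2 p_integral_divide_3
         simp del: divide_divide_eq_left divide_divide_eq_left'\<close>)
  thus *: "rat_cong p 1 (gen_harmonic n 2) 0"
    using rat_cong_weaken[OF gen_harmonic_2_cong_gen_harmonic_3, of 1] p_pos rat_cong_trans by auto
  have "rat_cong p 2 (gen_harmonic (2 * n) 2) (\<Sum>j=1..n. 2 * (1 / of_nat j ^ 2) + of_nat p * (2 / of_nat j ^ 3))"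
    unfolding gen_harmonic_def by (intro rat_cong_reflection inverse_square_reflection)
  hence "rat_cong p 2 (gen_harmonic (2 * n) 2) (2 * gen_harmonic n 2 + 2 * of_nat p * gen_harmonic n 3)"
    by (simp add: gen_harmonic_def sum.distrib sum_distrib_left mult_ac)
  hence "rat_cong p 1 (gen_harmonic (2 * n) 2) (2 * gen_harmonic n 2 + 2 * of_nat p * gen_harmonic n 3)"
    using rat_cong_weaken p_pos by force
  also have "rat_cong p 1 \<dots> (2 * 0 + 0)"
    by (intro rat_cong_add rat_cong_scale[OF *, of 2] rat_congI[of "2 * gen_harmonic n 3"])
      (use i p_pos in auto)
  finally show "rat_cong p 1 (gen_harmonic (2 * n) 2) 0" by simp
qed

lemma fermat_rat:
  assumes "\<not> p dvd j"
  shows "rat_cong p 1 (of_nat j ^ (p - 1)) 1"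
proof -
  have "[int (j ^ (p - 1)) = int 1] (mod int p)"
    using fermat_theorem[OF prime assms] by (simp only: cong_int_iff)
  from rat_cong_of_int[OF this] show ?thesis by simp
qed

lemma fermat_quotient_p_integral: "fermat_quotient p 2 \<in> p_integral p"
  using fermat_rat[of 2] not_dvd_below[of 2] gt3
  by (simp add: fermat_quotient_def rat_cong_iff_p_integral)

lemma power_eq_fermat_quotient: "2 ^ (p - 1) = 1 + of_nat p * fermat_quotient p 2"
  using p_pos by (simp add: fermat_quotient_def)

lemma power_cong_inverse_power:
  assumes "0 < j" "j < p" "s + l = p - 1"
  shows "rat_cong p 1 (of_nat j ^ l) (1 / of_nat j ^ s)"
proof (rule rat_cong_scale[OF fermat_rat])
  show "\<not> p dvd j" by (rule not_dvd_below) fact+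
  show "1 / of_nat j ^ s \<in> p_integral p" using assms by auto
  show "of_nat j ^ l - 1 / of_nat j ^ s = 1 / of_nat j ^ s * (of_nat j ^ (p - 1) - (1 :: rat))"
    using assms(1) unfolding assms(3)[symmetric] power_add by (simp add: field_simps)
qed

text \<open>With \<open>m = p - 3\<close>, and \<open>P\<close>, \<open>Q\<close> the half-range sums of
  \<open>j ^ (m - 1)\<close> and \<open>j ^ m\<close>, the two pairings read \<open>2 Q - m p P \<equiv> p
  B\<close> and \<open>2 (2 ^ m) Q - m p (2 ^ (m - 1)) P \<equiv> p B\<close>. Eliminating \<open>Q\<close>
  leaves \<open>p P \<equiv> - 2 p B\<close> because \<open>4 * 2 ^ m \<equiv> 1\<close> and \<open>m \<equiv> -
  3\<close>, and \<open>P\<close> is the sum of inverse cubes modulo \<open>p\<close>.\<close>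

lemma p_gen_harmonic_3_cong_bernoulli:
  "rat_cong p 2 (of_nat p * gen_harmonic n 3) (- 2 * of_nat p * bernoulli (p - 3))"
proof -
  define m where "m = p - 3"
  have n2: "n \<ge> 2" using gt3 p_eq by simp
  have m: "even m" "m > 0" "m + 2 < p" "m + 2 = p - 1" using n2 p_eq by (auto simp: m_def)
  define P Q where "P = (\<Sum>j=1..n. of_nat j ^ (m - 1) :: rat)" and "Q = (\<Sum>j=1..n. of_nat j ^ m :: rat)"
  define B q where "B = bernoulli m" and "q = fermat_quotient p 2"
  have int: "P \<in> p_integral p" "B \<in> p_integral p" "q \<in> p_integral p"
    unfolding P_def B_def q_def using m prime
    by (auto intro!: p_integral_sum bernoulli_p_integral fermat_quotient_p_integral)
  have S: "(\<Sum>j=1..2*n. of_nat j ^ m) = (\<Sum>j<p. of_nat j ^ m :: rat)"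
    by (rule sum.mono_neutral_left) (use m p_eq in auto)
  note refl = rat_cong_reflection[of "\<lambda>j. of_nat j ^ m" "\<lambda>j. - of_nat m * of_nat j ^ (m - 1)",
      OF power_reflection[OF m(1,2)], unfolded S]
  have 1: "(\<Sum>j=1..n. 2 * of_nat j ^ m + of_nat p * (- of_nat m * of_nat j ^ (m - 1))) =
      2 * Q - of_nat m * of_nat p * P"
    by (simp add: P_def Q_def sum_subtractf sum_distrib_left mult_ac)
  have 2: "(\<Sum>j=1..n. 2 * of_nat (2 * j) ^ m + of_nat p * (- of_nat m * of_nat (2 * j) ^ (m - 1))) =
      2 * 2 ^ m * Q - of_nat m * of_nat p * 2 ^ (m - 1) * P"
    by (simp add: P_def Q_def sum_subtractf sum_distrib_left mult_ac power_mult_distrib)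
  have S_B: "rat_cong p 2 (\<Sum>j<p. of_nat j ^ m) (of_nat p * B)"
    unfolding B_def using power_sum_cong_bernoulli[OF prime, of m] m by simp
  from rat_congE[OF rat_cong_trans[OF rat_cong_sym[OF refl(1)] S_B] p_pos] obtain c
    where c: "c \<in> p_integral p" "2 * Q - of_nat m * of_nat p * P = of_nat p * B + of_nat p ^ 2 * c"
    unfolding 1 by blast
  from rat_congE[OF rat_cong_trans[OF rat_cong_sym[OF refl(2)] S_B] p_pos] obtain d
    where d: "d \<in> p_integral p"
      "2 * 2 ^ m * Q - of_nat m * of_nat p * 2 ^ (m - 1) * P = of_nat p * B + of_nat p ^ 2 * d"
    unfolding 2 by blast
  have u: "4 * 2 ^ m = 1 + of_nat p * q"
    using power_eq_fermat_quotient unfolding m(4)[symmetric] q_def by (simp add: power_add)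
  have v: "8 * 2 ^ (m - 1) = (4 * 2 ^ m :: rat)" using m(2) by (cases m) auto
  have mr: "of_nat m = (of_nat p - 3 :: rat)" using gt3 by (simp add: m_def of_nat_diff)
  \<comment> \<open>\<open>Q\<close> cancels from this combination; the factor \<open>8\<close> makes every power of two a multiple of \<open>2 ^ (p - 1)\<close>\<close>
  have "2 * (4 * 2 ^ m) * (2 * Q - of_nat m * of_nat p * P)
      - 8 * (2 * 2 ^ m * Q - of_nat m * of_nat p * 2 ^ (m - 1) * P)
    = (8 * 2 ^ (m - 1)) * of_nat m * of_nat p * P - 2 * (4 * 2 ^ m) * of_nat m * of_nat p * P"
    by (simp add: algebra_simps)
  note eq = this[unfolded c(2) d(2), unfolded v, unfolded u mr]
  \<comment> \<open>the remainder that the elimination leaves behind, read off from \<open>eq\<close>\<close>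
  define r where "r = P + (of_nat p - 3) * q * P + 2 * q * B + 2 * (1 + of_nat p * q) * c - 8 * d"
  have "3 * (of_nat p * P + 2 * of_nat p * B) = of_nat p ^ 2 * r"
    using eq unfolding r_def by (simp add: algebra_simps power2_eq_square)
  hence "of_nat p * P = - 2 * of_nat p * B + of_nat p ^ 2 * (r / 3)"
    by (simp add: field_simps)
  moreover have "r / 3 \<in> p_integral p"
    unfolding r_def using int c d by (intro p_integral_divide_3) auto
  ultimately have cong_B: "rat_cong p 2 (of_nat p * P) (- 2 * of_nat p * B)"
    using rat_congI p_pos by blast
  have "rat_cong p 1 P (gen_harmonic n 3)"
    unfolding P_def gen_harmonic_def using m p_eq
    by (intro rat_cong_sum power_cong_inverse_power) auto
  hence "rat_cong p 2 (of_nat p * P) (of_nat p * gen_harmonic n 3)"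
    by (rule rat_cong_shift[of _ _ _ _ 1]) (use p_pos in \<open>auto simp: algebra_simps\<close>)
  thus ?thesis
    using rat_cong_trans[OF rat_cong_sym cong_B] unfolding B_def m_def by blast
qed

lemma gen_harmonic_2_cong_bernoulli:
  "rat_cong p 2 (gen_harmonic n 2) (7 / 3 * of_nat p * bernoulli (p - 3))"
proof -
  have "rat_cong p 2 (- 7 / 6 * of_nat p * gen_harmonic n 3) (7 / 3 * of_nat p * bernoulli (p - 3))"
  proof (rule rat_cong_scale[OF p_gen_harmonic_3_cong_bernoulli])
    show "- 7 / 2 / 3 \<in> p_integral p"
      by (intro p_integral_divide_2 p_integral_divide_3) simp
  qed (simp add: field_simps)
  with gen_harmonic_2_cong_gen_harmonic_3 show ?thesis by (rule rat_cong_trans)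
qed

text \<open>With \<open>h\<close> the harmonic sum and \<open>q\<close> the Fermat quotient, the duplication
  formula expanded to second order is \<open>1 - p h + p\<^sup>2 h\<^sup>2 / 2 \<equiv> (1 + p q) (1 - p h / 2 +
  p\<^sup>2 h\<^sup>2 / 8)\<close> modulo \<open>p\<^sup>3\<close>, as the sum of inverse squares vanishes
  modulo \<open>p\<close>. This gives \<open>h \<equiv> - 2 q\<close> modulo \<open>p\<close>, and substituting
  that value into the quadratic terms gives the statement.\<close>

lemma gen_harmonic_1_cong_fermat_quotient:
  "rat_cong p 2 (gen_harmonic n 1) (- 2 * fermat_quotient p 2 + of_nat p * fermat_quotient p 2 ^ 2)"
proof -
  define h q and P :: rat where "h = gen_harmonic n 1" and "q = fermat_quotient p 2" and "P = of_nat p"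
  have P: "P \<noteq> 0" "P \<in> p_integral p" using p_pos by (auto simp: P_def)
  have h: "h \<in> p_integral p" and q: "q \<in> p_integral p"
    unfolding h_def q_def by (auto intro: fermat_quotient_p_integral)
  have odd: "odd p" using p_eq by simp
  obtain e where e: "e \<in> p_integral p" "gen_harmonic n 2 = P * e"
    using rat_congE[OF gen_harmonic_2_cong_0 p_pos] unfolding P_def by auto
  \<comment> \<open>the second elementary symmetric function of the inverses\<close>
  define e2 where "e2 = (h\<^sup>2 - P * e) / 2"
  have int: "- 1 / of_nat j ^ 1 \<in> p_integral p" "- 1 / 2 / of_nat j ^ 1 \<in> p_integral p"
    if "j \<in> {1..n}" for j
  proof -
    have "0 < j" "j < p" using that by (auto simp: p_eq)
    moreover have "- 1 \<in> p_integral p" "- 1 / 2 \<in> p_integral p"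
      by (simp, rule p_integral_divide_2, simp)
    ultimately show "- 1 / of_nat j ^ 1 \<in> p_integral p" "- 1 / 2 / of_nat j ^ 1 \<in> p_integral p"
      using p_integral_divide_power by blast+
  qed
  have "rat_cong p 3 (\<Prod>j=1..n. 1 + of_nat p * (- 1 / of_nat j ^ 1))
     (1 + of_nat p * (\<Sum>j=1..n. - 1 / of_nat j ^ 1) + of_nat p ^ 2 *
      (((\<Sum>j=1..n. - 1 / of_nat j ^ 1) ^ 2 - (\<Sum>j=1..n. (- 1 / of_nat j ^ 1) ^ 2)) / 2))"
    by (rule rat_cong_prod_second_order[OF int(1) prime odd])
  also have "(\<Sum>j=1..n. - 1 / of_nat j ^ 1) = - h"
    by (simp add: h_def gen_harmonic_def sum_negf)
  also have "(\<Sum>j=1..n. (- 1 / of_nat j ^ 1) ^ 2) = P * e"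
    unfolding e(2)[symmetric] by (simp add: gen_harmonic_def power_divide)
  finally obtain c where c: "c \<in> p_integral p"
    "(\<Prod>j=1..n. 1 - of_nat p / of_nat j) = 1 - P * h + P ^ 2 * e2 + P ^ 3 * c"
    by (elim rat_congE[OF _ p_pos]) (auto simp: e2_def P_def)
  have "rat_cong p 3 (\<Prod>j=1..n. 1 + of_nat p * (- 1 / 2 / of_nat j ^ 1))
     (1 + of_nat p * (\<Sum>j=1..n. - 1 / 2 / of_nat j ^ 1) + of_nat p ^ 2 *
      (((\<Sum>j=1..n. - 1 / 2 / of_nat j ^ 1) ^ 2 - (\<Sum>j=1..n. (- 1 / 2 / of_nat j ^ 1) ^ 2)) / 2))"
    by (rule rat_cong_prod_second_order[OF int(2) prime odd])
  also have "(\<Sum>j=1..n. - 1 / 2 / of_nat j ^ 1) = - h / 2"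
    by (simp add: h_def gen_harmonic_def sum_negf sum_divide_distrib mult_ac)
  also have "(\<Sum>j=1..n. (- 1 / 2 / of_nat j ^ 1) ^ 2) = P * e / 4"
    unfolding e(2)[symmetric]
    by (simp add: gen_harmonic_def power_divide power_mult_distrib sum_divide_distrib mult_ac)
  finally obtain d where d: "d \<in> p_integral p"
    "(\<Prod>j=1..n. 1 - of_nat p / (2 * of_nat j)) = 1 - P * h / 2 + P ^ 2 * e2 / 4 + P ^ 3 * d"
    by (elim rat_congE[OF _ p_pos]) (auto simp: e2_def P_def power_divide field_simps)
  have pow: "2 ^ (2 * n) = 1 + P * q"
    using power_eq_fermat_quotient p_eq by (simp add: P_def q_def)
  have "1 - P * h + P ^ 2 * e2 + P ^ 3 * c = (1 + P * q) * (1 - P * h / 2 + P ^ 2 * e2 / 4 + P ^ 3 * d)"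
    using prod_one_minus_div_duplication[of n] unfolding p_eq[symmetric] c d pow .
  hence "P * h = P * (- 2 * q + P * (3 / 2 * e2 + q * h) + P ^ 2 * (2 * c - 2 * (1 + P * q) * d - q * e2 / 2))"
    by (simp add: field_simps power2_eq_square power3_eq_cube)
  hence h_eq: "h = - 2 * q + P * (3 / 2 * e2 + q * h) + P ^ 2 * (2 * c - 2 * (1 + P * q) * d - q * e2 / 2)"
    using P by simp
  \<comment> \<open>\<open>h = - 2 q + p g\<close> is the congruence modulo \<open>p\<close>, to be substituted into the terms of order \<open>p\<close>\<close>
  define k where "k = 2 * c - 2 * (1 + P * q) * d - q * e2 / 2"
  define g where "g = 3 / 2 * e2 + q * h + P * k"
  have e2: "e2 \<in> p_integral p" unfolding e2_def using h P e by (intro p_integral_divide_2) auto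
  have k: "k \<in> p_integral p" unfolding k_def using c d P q e2 by (auto intro!: p_integral_divide_2 simp del: times_divide_eq_right times_divide_eq_left)
  have "3 / 2 * e2 \<in> p_integral p" using e2 p_integral_divide_2 by auto
  hence g: "g \<in> p_integral p" unfolding g_def using P q h k by auto
  have hg: "h = - 2 * q + P * g" using h_eq unfolding g_def k_def by (simp add: algebra_simps power2_eq_square)
  have X: "3 / 2 * e2 + q * h = q ^ 2 + P * (- 2 * q * g + 3 / 4 * P * g ^ 2 - 3 / 4 * e)"
    unfolding e2_def hg by (simp add: field_simps power2_eq_square)
  have "h = - 2 * q + P * q ^ 2 + P ^ 2 * (- 2 * q * g + 3 / 2 / 2 * P * g ^ 2 - 3 / 2 / 2 * e + k)"
    using h_eq[folded k_def, unfolded X] by (simp add: algebra_simps power2_eq_square)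
  moreover have "3 / 2 / 2 \<in> p_integral p" by (intro p_integral_divide_2) auto
  hence "- 2 * q * g + 3 / 2 / 2 * P * g ^ 2 - 3 / 2 / 2 * e + k \<in> p_integral p"
    using P q g k e(1) by (intro p_integral_add p_integral_diff p_integral_mult p_integral_power) auto
  ultimately show ?thesis
    unfolding h_def q_def P_def using rat_congI[OF _ _ p_pos] by blast
qed


section \<open>The three congruences\<close>

lemma sine_prod_cong:
  assumes "k < p"
  shows "rat_cong p 4 (sine_prod p k) (1 - of_nat p ^ 2 * gen_harmonic k 2)"
proof -
  have "- 1 / of_nat j ^ 2 \<in> p_integral p" if "j \<in> {1..k}" for j
    using that assms by (intro p_integral_divide_power) auto
  from rat_cong_prod_first_order[of "{1..k}" "\<lambda>j. - 1 / of_nat j ^ 2", OF this p_pos, of 2]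
  have "rat_cong p 4 (\<Prod>j=1..k. 1 + of_nat p ^ 2 * (- 1 / of_nat j ^ 2))
      (1 + of_nat p ^ 2 * (\<Sum>j=1..k. - 1 / of_nat j ^ 2))" by simp
  thus ?thesis by (simp add: sine_prod_def gen_harmonic_def sum_negf)
qed

lemma sine_prod_cong_1:
  assumes "k < p"
  shows "rat_cong p 2 (sine_prod p k) 1"
proof -
  have "rat_cong p 2 (sine_prod p k) (1 - of_nat p ^ 2 * gen_harmonic k 2)"
    using rat_cong_weaken[OF sine_prod_cong[OF assms], of 2] p_pos by simp
  also have "rat_cong p 2 \<dots> 1"
    by (rule rat_congI[of "- gen_harmonic k 2"]) (use assms p_pos in auto)
  finally show ?thesis .
qed

lemma sine_prod_cong_1_of_gen_harmonic:
  assumes "k < p" "rat_cong p 1 (gen_harmonic k 2) 0"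
  shows "rat_cong p 3 (sine_prod p k) 1"
proof -
  have "rat_cong p 3 (sine_prod p k) (1 - of_nat p ^ 2 * gen_harmonic k 2)"
    using rat_cong_weaken[OF sine_prod_cong[OF assms(1)], of 3] p_pos by simp
  also have "rat_cong p 3 \<dots> 1"
    by (rule rat_cong_shift[OF assms(2), of "-1"]) (use p_pos in auto)
  finally show ?thesis .
qed

text \<open>The pair \<open>2 j, p - 2 j\<close> contributes \<open>- 1 / (2 j) + 1 / (p - 2 j) \<equiv> - 1 / j
  - p / (4 j\<^sup>2)\<close>, and the inverse squares sum to \<open>0\<close> modulo \<open>p\<close>.\<close>

lemma alternating_sum_inverse_cong:
  "rat_cong p 2 (\<Sum>k<2*n. (-1) ^ k / of_nat (k + 1)) (- gen_harmonic n 1)"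
proof -
  have "(\<Sum>k<2*n. (-1) ^ k / of_nat (k + 1)) = (\<Sum>j=1..2*n. - ((-1) ^ j) / of_nat j :: rat)"
    by (rule sum.reindex_bij_witness[of _ "\<lambda>j. j - 1" Suc]) (auto simp: power_Suc)
  also have "\<dots> = (\<Sum>j=1..n. - 1 / of_nat (2 * j) + 1 / of_nat (1 * p - 2 * j))"
    unfolding sum.pair_parity by (rule sum.cong) (auto simp: p_eq)
  also have "rat_cong p 2 \<dots> (\<Sum>j=1..n. - 1 / of_nat (2 * j)
      + (- (1 / of_nat (2 * j)) - of_nat (1 * p) / of_nat (2 * j) ^ 2))"
    by (intro rat_cong_sum rat_cong_add rat_cong_refl inverse_reflection not_dvd_below)
      (auto simp: p_eq not_dvd_below)
  also have "\<dots> = - gen_harmonic n 1 - of_nat p * gen_harmonic n 2 / 4"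
  proof -
    have "- 1 / of_nat (2 * j) + (- (1 / of_nat (2 * j)) - of_nat (1 * p) / of_nat (2 * j) ^ 2) =
        - (1 / of_nat j ^ 1) - of_nat p / 4 * (1 / of_nat j ^ 2 :: rat)" if "j > 0" for j
      using that by (simp add: field_simps power2_eq_square)
    thus ?thesis by (simp add: gen_harmonic_def sum_subtractf sum_negf sum_distrib_left sum_divide_distrib mult_ac)
  qed
  also have "rat_cong p 2 \<dots> (- gen_harmonic n 1)"
  proof (rule rat_cong_shift[OF gen_harmonic_2_cong_0])
    show "- 1 / 2 / 2 \<in> p_integral p" by (intro p_integral_divide_2) auto
  qed (use p_pos in auto)
  finally show ?thesis .
qed

lemma Legendre_neg_1: "Legendre (-1) (int p) = (-1) ^ n"
proof -
  have "[Legendre (-1) (int p) = (-1) ^ ((p - 1) div 2)] (mod int p)"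
    using euler_criterion[OF prime, of "-1"] gt3 by simp
  hence "int p dvd Legendre (-1) (int p) - (-1) ^ n"
    by (simp add: p_eq cong_iff_dvd_diff)
  moreover have "\<bar>Legendre (-1) (int p) - (-1) ^ n\<bar> \<le> 2"
    by (auto simp: Legendre_def minus_one_power_iff)
  ultimately show ?thesis using gt3 zdvd_not_zless[of "\<bar>Legendre (-1) (int p) - (-1) ^ n\<bar>" "int p"]
    by (cases "Legendre (-1) (int p) - (-1) ^ n = 0") auto
qed

lemma sum_delannoy_cong:
  "rat_cong p 3 (\<Sum>k<p. of_nat (delannoy k))
     (of_int (Legendre (-1) (int p)) - of_nat p ^ 2 * of_int (euler_number (p - 3)))"
proof -
  define m where "m = p - 3"
  have m: "even m" "m > 0" "2 + m = p - 1" using gt3 p_eq by (auto simp: m_def)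
  define g where "g k = of_nat p * (-1) ^ k * sine_prod p k / of_nat (2 * k + 1)" for k
  have off_centre: "rat_cong p 3 (g k) (of_nat p * (-1) ^ k / of_nat (2 * k + 1))"
    if "k < p" "k \<noteq> n" for k
  proof -
    \<comment> \<open>the only odd multiple of \<open>p\<close> below \<open>2 p\<close> is \<open>p\<close> itself, attained at \<open>k = n\<close>\<close>
    have "\<not> p dvd 2 * k + 1"
    proof
      assume "p dvd 2 * k + 1"
      then obtain q where q: "2 * k + 1 = p * q" by blast
      have "q < 2"
      proof (rule ccontr)
        assume "\<not> q < 2"
        hence "p * 2 \<le> p * q" by simp
        thus False using q that by linarith
      qed
      with q have "q = 1" by (cases q) auto
      thus False using q that p_eq by simp
    qed
    hence "(-1) ^ k / of_nat (2 * k + 1) \<in> p_integral p"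
      by (intro p_integral_divide_of_nat prime) auto
    hence "rat_cong p 3 (g k) (of_nat p * (-1) ^ k / of_nat (2 * k + 1))"
      by (rule rat_cong_shift[OF sine_prod_cong_1[OF that(1)]])
        (use p_pos in \<open>auto simp: g_def right_diff_distrib diff_divide_distrib\<close>)
    thus ?thesis .
  qed
  have "g n = (-1) ^ n * sine_prod p n"
    unfolding g_def p_eq[symmetric] using p_pos by simp
  hence centre: "rat_cong p 3 (g n) ((-1) ^ n)"
    by (intro rat_cong_scale[OF sine_prod_cong_1_of_gen_harmonic[OF n_less(1) gen_harmonic_2_cong_0], of "(-1) ^ n"])
      (auto simp: right_diff_distrib)
  have pair: "rat_cong p 3 (g k + g (2 * n - k)) (- (of_nat p ^ 2) * (2 * ((-1) ^ k * of_nat (2 * k + 1) ^ m)))"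
    if k: "k < n" for k
  proof -
    define a :: rat where "a = of_nat (2 * k + 1)"
    have eq: "2 * (2 * n - k) + 1 = 2 * p - (2 * k + 1)" using k p_eq by simp
    have "\<not> p dvd 2 * p - (2 * k + 1)"
    proof
      assume "p dvd 2 * p - (2 * k + 1)"
      note dvd_diff_nat[OF dvd_triv_right[of p 2] this]
      moreover have "2 * p - (2 * p - (2 * k + 1)) = 2 * k + 1" using k p_eq by simp
      ultimately have "p dvd 2 * k + 1" by (simp only:)
      thus False using k p_eq not_dvd_below[of "2 * k + 1"] by simp
    qed
    hence "rat_cong p 2 (1 / of_nat (2 * p - (2 * k + 1))) (- (1 / a) - of_nat (2 * p) / a ^ 2)"
      unfolding a_def using k p_eq by (intro inverse_reflection) auto
    hence 1: "rat_cong p 3 (of_nat p * (-1) ^ k / a + of_nat p * (-1) ^ k / of_nat (2 * p - (2 * k + 1)))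
        (- (of_nat p ^ 2) * (2 * ((-1) ^ k * (1 / a ^ 2))))"
      by (rule rat_cong_shift[where c = "(-1) ^ k"])
        (use p_pos in \<open>auto simp: algebra_simps power2_eq_square add_divide_distrib\<close>)
    have "rat_cong p 1 (a ^ m) (1 / a ^ 2)"
      unfolding a_def by (rule power_cong_inverse_power) (use k p_eq m in auto)
    from rat_cong_sym[OF this]
    have 2: "rat_cong p 3 (- (of_nat p ^ 2) * (2 * ((-1) ^ k * (1 / a ^ 2))))
        (- (of_nat p ^ 2) * (2 * ((-1) ^ k * a ^ m)))"
      by (rule rat_cong_shift[where c = "- 2 * (-1) ^ k"])
        (use p_pos in \<open>auto simp: algebra_simps\<close>)
    have "rat_cong p 3 (g k + g (2 * n - k))
        (of_nat p * (-1) ^ k / of_nat (2 * k + 1) + of_nat p * (-1) ^ (2 * n - k) / of_nat (2 * (2 * n - k) + 1))"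
      by (intro rat_cong_add off_centre) (use k p_eq in auto)
    also have "(-1) ^ (2 * n - k) = ((-1) ^ k :: rat)"
      using k by (simp add: minus_one_power_iff)
    finally show ?thesis
      using rat_cong_trans[OF _ rat_cong_trans[OF 1[unfolded a_def] 2[unfolded a_def]]]
      unfolding eq by blast
  qed
  have "(\<Sum>k<p. g k) = g n + (\<Sum>k<n. g k + g (2 * n - k))"
  proof -
    have "{..<p} = insert n ({..<n} \<union> {n+1..2*n})" by (auto simp: p_eq)
    hence "(\<Sum>k<p. g k) = g n + ((\<Sum>k<n. g k) + (\<Sum>k=n+1..2*n. g k))"
      by (simp add: sum.union_disjoint disjoint_iff)
    also have "(\<Sum>k=n+1..2*n. g k) = (\<Sum>k<n. g (2 * n - k))"
      by (rule sum.reindex_bij_witness[of _ "\<lambda>k. 2 * n - k" "\<lambda>k. 2 * n - k"]) auto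
    finally show ?thesis by (simp add: sum.distrib)
  qed
  also have "rat_cong p 3 \<dots> ((-1) ^ n + (\<Sum>k<n. - (of_nat p ^ 2) * (2 * ((-1) ^ k * of_nat (2 * k + 1) ^ m))))"
    by (intro rat_cong_add centre rat_cong_sum pair) auto
  also have "\<dots> = (-1) ^ n - of_nat p ^ 2 * of_int (2 * (\<Sum>k<n. (-1) ^ k * int (2 * k + 1) ^ m))"
    by (simp add: sum_distrib_left sum_negf)
  also have "rat_cong p 3 \<dots> ((-1) ^ n - of_nat p ^ 2 * of_int (euler_number m))"
    by (rule rat_cong_shift[OF rat_cong_of_int[OF alternating_odd_power_sum_cong_euler[OF m(1,2) p_eq]],
          of "-1"]) (use p_pos in \<open>auto simp: algebra_simps\<close>)
  finally show ?thesis
    unfolding sum_delannoy g_def Legendre_neg_1 m_def by simp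
qed

text \<open>In the alternating sum over an interval ending at an even index, each \<open>1 / j\<^sup>2\<close>
  with odd \<open>j\<close> cancels and each one with even \<open>j\<close> occurs once.\<close>

lemma sum_alternating_gen_harmonic_2: "(\<Sum>k<2*N+1. (-1) ^ k * gen_harmonic k 2) = gen_harmonic N 2 / 4"
proof (induction N)
  case (Suc N)
  have "gen_harmonic (2 * N + 2) 2 - gen_harmonic (2 * N + 1) 2 = 1 / of_nat (2 * (N + 1)) ^ 2"
    by (simp add: gen_harmonic_def)
  also have "\<dots> = 1 / of_nat (Suc N) ^ 2 / 4"
    unfolding of_nat_mult power_mult_distrib by simp
  finally show ?case using Suc.IH by (simp add: gen_harmonic_def)
qed (simp add: gen_harmonic_def)

lemma sum_alternating_weighted_delannoy_cong:
  "rat_cong p 5 (\<Sum>k<p. (2 * of_nat k + 1) * (-1) ^ k * of_nat (delannoy k))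
     (of_nat p - 7 / 12 * of_nat p ^ 4 * bernoulli (p - 3))"
proof -
  have "odd p" using p_eq by simp
  hence "(\<Sum>k<p. (2 * of_nat k + 1) * (-1) ^ k * of_nat (delannoy k)) =
     (\<Sum>k<p. of_nat p * (-1) ^ k * sine_prod p k)"
    by (rule sum_alternating_weighted_delannoy)
  also have "rat_cong p 5 \<dots> (\<Sum>k<p. of_nat p * (-1) ^ k * (1 - of_nat p ^ 2 * gen_harmonic k 2))"
  proof (rule rat_cong_sum)
    fix k assume "k \<in> {..<p}"
    thus "rat_cong p 5 (of_nat p * (-1) ^ k * sine_prod p k)
        (of_nat p * (-1) ^ k * (1 - of_nat p ^ 2 * gen_harmonic k 2))"
      by (intro rat_cong_shift[OF sine_prod_cong, of _ "(-1) ^ k"])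
        (use p_pos in \<open>auto simp: right_diff_distrib\<close>)
  qed
  also have "(\<Sum>k<p. of_nat p * (-1) ^ k * (1 - of_nat p ^ 2 * gen_harmonic k 2)) =
      of_nat p * (\<Sum>k<p. (-1) ^ k) - of_nat p ^ 3 * (\<Sum>k<p. (-1) ^ k * gen_harmonic k 2)"
    by (simp add: sum_distrib_left sum_subtractf right_diff_distrib power2_eq_square power3_eq_cube mult_ac)
  also have "(\<Sum>k<p. (-1) ^ k) = (1 :: rat)"
  proof -
    have "(\<Sum>k<2*N+1. (-1) ^ k) = (1 :: rat)" for N by (induction N) auto
    thus ?thesis unfolding p_eq .
  qed
  also have "(\<Sum>k<p. (-1) ^ k * gen_harmonic k 2) = gen_harmonic n 2 / 4"
    using sum_alternating_gen_harmonic_2[of n] unfolding p_eq .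
  also have "rat_cong p 5 (of_nat p * 1 - of_nat p ^ 3 * (gen_harmonic n 2 / 4))
      (of_nat p - 7 / 12 * of_nat p ^ 4 * bernoulli (p - 3))"
  proof (rule rat_cong_shift[OF gen_harmonic_2_cong_bernoulli])
    show "- 1 / 2 / 2 \<in> p_integral p" by (intro p_integral_divide_2) auto
  qed (use p_pos in \<open>auto simp: field_simps power4_eq_xxxx power3_eq_cube\<close>)
  finally show ?thesis .
qed

lemma sum_weighted_delannoy_cong:
  "rat_cong p 4 (\<Sum>k<p. (2 * of_nat k + 1) * of_nat (delannoy k))
     (of_nat p + 2 * of_nat p ^ 2 * fermat_quotient p 2 - of_nat p ^ 3 * fermat_quotient p 2 ^ 2)"
proof -
  have "(\<Sum>k<p. (2 * of_nat k + 1) * of_nat (delannoy k)) =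
      (\<Sum>k<2*n. of_nat p ^ 2 * (-1) ^ k * sine_prod p k / of_nat (k + 1)) + of_nat p * sine_prod p (2 * n)"
  proof -
    have "of_nat p ^ 2 * (-1) ^ (2 * n) * sine_prod p (2 * n) / of_nat (2 * n + 1) = of_nat p * sine_prod p (2 * n)"
      unfolding p_eq[symmetric] using p_pos by (simp add: power2_eq_square)
    moreover have "(\<Sum>k<p. f k) = (\<Sum>k<2*n. f k) + f (2 * n)" for f :: "nat \<Rightarrow> rat"
      by (simp add: p_eq)
    ultimately show ?thesis unfolding sum_weighted_delannoy by simp
  qed
  also have "rat_cong p 4 \<dots> ((\<Sum>k<2*n. of_nat p ^ 2 * (-1) ^ k / of_nat (k + 1)) + of_nat p * 1)"
  proof (intro rat_cong_add rat_cong_sum)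
    fix k assume "k \<in> {..<2*n}"
    hence k: "k < p" "k + 1 < p" using p_eq by auto
    have "(-1) ^ k / of_nat (k + 1) ^ 1 \<in> p_integral p"
      by (rule p_integral_divide_power) (use k in auto)
    hence "rat_cong p 4 (of_nat p ^ 2 * (-1) ^ k * sine_prod p k / of_nat (k + 1))
        (of_nat p ^ 2 * (-1) ^ k / of_nat (k + 1))"
      by (rule rat_cong_shift[OF sine_prod_cong_1[OF k(1)]])
        (use p_pos in \<open>auto simp: right_diff_distrib diff_divide_distrib\<close>)
    thus "rat_cong p 4 (of_nat p ^ 2 * (-1) ^ k * sine_prod p k / of_nat (k + 1))
        (of_nat p ^ 2 * (-1) ^ k / of_nat (k + 1))" by simp
  next
    show "rat_cong p 4 (of_nat p * sine_prod p (2 * n)) (of_nat p * 1)"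
      by (rule rat_cong_shift[OF sine_prod_cong_1_of_gen_harmonic[OF n_less(2) gen_harmonic_2_full_cong_0], of 1])
        (use p_pos in \<open>auto simp: algebra_simps\<close>)
  qed
  also have "(\<Sum>k<2*n. of_nat p ^ 2 * (-1) ^ k / of_nat (k + 1)) =
      of_nat p ^ 2 * (\<Sum>k<2*n. (-1) ^ k / of_nat (k + 1) :: rat)"
    by (simp add: sum_distrib_left)
  also have "rat_cong p 4 (of_nat p ^ 2 * (\<Sum>k<2*n. (-1) ^ k / of_nat (k + 1)) + of_nat p * 1)
      (of_nat p ^ 2 * (- gen_harmonic n 1) + of_nat p * 1)"
    by (rule rat_cong_shift[OF alternating_sum_inverse_cong, of 1])
      (use p_pos in \<open>auto simp: ring_distribs\<close>)
  also have "rat_cong p 4 \<dots> (of_nat p ^ 2 * - (- 2 * fermat_quotient p 2 +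
      of_nat p * fermat_quotient p 2 ^ 2) + of_nat p * 1)"
    by (rule rat_cong_shift[OF gen_harmonic_1_cong_fermat_quotient, of "-1"])
      (use p_pos in \<open>auto simp: ring_distribs\<close>)
  finally show ?thesis by (simp add: algebra_simps power2_eq_square power3_eq_cube)
qed

end

theorem theorem1p4:
  fixes p :: nat
  assumes "prime p" and "p > 3"
  shows "rat_cong p 3
           (\<Sum>k=0..p-1. of_nat (delannoy k))
           (of_int (Legendre (-1) (int p)) - of_nat p ^ 2 * of_int (euler_number (p - 3)))
    \<and> rat_cong p 5
           (\<Sum>k=0..p-1. (2 * of_nat k + 1) * (-1) ^ k * of_nat (delannoy k))
           (of_nat p - 7 / 12 * of_nat p ^ 4 * bernoulli (p - 3))
    \<and> rat_cong p 4
           (\<Sum>k=0..p-1. (2 * of_nat k + 1) * of_nat (delannoy k))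
           (of_nat p + 2 * of_nat p ^ 2 * fermat_quotient p 2
             - of_nat p ^ 3 * (fermat_quotient p 2) ^ 2)"
proof -
  have "odd p" using assms prime_odd_nat by auto
  then obtain n where n: "p = 2 * n + 1" by (elim oddE)
  have range: "{0..p-1} = {..<p}" using assms(2) by auto
  show ?thesis
    unfolding range
    by (intro conjI sum_delannoy_cong[OF assms(1) n assms(2)] sum_weighted_delannoy_cong[OF assms(1) n assms(2)]
        sum_alternating_weighted_delannoy_cong[OF assms(1) n assms(2)])
qed

end
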